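(* Let $h,k>0$ be real numbers with $2h^2/k<1$, let $\lambda\in\Lambda$ (the Leech lattice), and let $\operatorname{Re}(s)>25$. Put $a^*_\lambda(k,h,s)=(h/2\pi)^s\,\Gamma(s)\,a_\lambda(k,h,s)$ and $c_n=\sqrt{\tfrac{k}{h^2}-\tfrac{2}{n^2}}$ for $n\ge1$. If $\lambda\neq0$, then $$a^*_\lambda(k,h,s)=2\bigl(1+\mathrm{e}(-\tfrac{s}{2})\bigr)|\lambda|^{s-12}\sum_{n\ge1}j_{\lambda,n}\,n^{-s}\,c_n^{12-s}\,K_{12-s}(2\pi|\lambda|c_n),$$ and if $\lambda=0$, then $$a^*_0(k,h,s)=\bigl(1+\mathrm{e}(-\tfrac{s}{2})\bigr)\Gamma(s-12)\,\pi^{12-s}\sum_{n\ge1}j_{0,n}\,n^{-s}\,c_n^{24-2s}.$$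
   Context: $\Lambda$ is the Leech lattice (the unique positive definite even self-dual lattice of rank 24 with no vectors of norm 2), and $L=\Lambda\oplus\mathrm{II}_{1,1}$ (the even self-dual lattice of signature $(25,1)$), whose elements are written $(\lambda;m,n)$ with $\lambda\in\Lambda$, $m,n\in\mathbb{Z}$ and norm $(\lambda;m,n)^2=\lambda^2-2mn$, i.e. $\langle(\lambda;m,n)|(\lambda';m',n')\rangle=\langle\lambda|\lambda'\rangle-mn'-m'n$; the same coordinates are used on $V=L\otimes\mathbb{R}$. $L(2)$ is the set of norm 2 vectors (roots) of $L$. Write $\mathrm{e}(x)=\exp(2\pi i x)$ and $|\lambda|=\sqrt{\lambda^2}$. For $\operatorname{Re}(s)>25$ and $z\in V$ with $z^2<0$ not orthogonal to any root, $$E(z,s)=\sum_{r\in L(2)}\langle r|z\rangle^{-s},$$ where the branch of the logarithm is chosen so that $(-1)^s=\mathrm{e}(s/2)$, i.e. for $x<0$, $x^{-s}=|x|^{-s}\mathrm{e}(-s/2)$. Let $S_{k,h}=\{z\in V: z^2=-k,\ z=( *;h,* )\}$ and let $\phi:\Lambda\otimes\mathbb{R}\to S_{k,h}$ be the bijection $\phi(v)=\bigl(hv;\,h,\,\tfrac{h^2v^2+k}{2h}\bigr)$. When $2h^2/k<1$, $S_{k,h}$ meets no hyperplane orthogonal to a root, and $v\mapsto E(\phi(v),s)$ is $\Lambda$-periodic. Its Fourier coefficients are $$a_\lambda(k,h,s)=\int_{(\Lambda\otimes\mathbb{R})/\Lambda}E(\phi(v),s)\,\mathrm{e}(-\langle\lambda|v\rangle)\,dv,$$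 with $dv$ the Lebesgue measure giving $(\Lambda\otimes\mathbb{R})/\Lambda$ volume 1. Further, $$j_{\lambda,n}=\sum_{l\in\Lambda/n\Lambda,\ l^2/2\equiv1\bmod n}\mathrm{e}(\langle l|\lambda\rangle/n),$$ and $K_\nu$ is the modified Bessel (Macdonald) function. *)

theory Defs
  imports "HOL-Analysis.Analysis" "HOL-Library.Real_Mod"
begin

definition full_lattice :: "(real ^ 'n) set \<Rightarrow> bool" where
  "full_lattice \<Lambda> \<longleftrightarrow>
     (\<exists>B :: real ^ 'n ^ 'n. invertible B \<and> \<Lambda> = {B *v x | x. \<forall>i. x $ i \<in> \<int>})"

definition dual_lattice :: "(real ^ 'n) set \<Rightarrow> (real ^ 'n) set" where
  "dual_lattice \<Lambda> = {x. \<forall>y\<in>\<Lambda>. x \<bullet> y \<in> \<int>}"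

text \<open>
  The \<^emph>\<open>norm\<close> of a lattice vector \<open>x\<close> is \<open>x \<bullet> x\<close>, not its square root. A positive definite
  lattice of rank 24 is taken inside its real span, identified isometrically with Euclidean
  24-space; the conditions below then fix \<open>\<Lambda>\<close> up to an orthogonal transformation.
\<close>

definition leech_lattice :: "(real ^ 24) set \<Rightarrow> bool" where
  "leech_lattice \<Lambda> \<longleftrightarrow>
     full_lattice \<Lambda> \<and>
     (\<forall>x\<in>\<Lambda>. x \<bullet> x / 2 \<in> \<int>) \<and>
     dual_lattice \<Lambda> = \<Lambda> \<and>
     (\<forall>x\<in>\<Lambda>. x \<bullet> x \<noteq> 2)"

type_synonym lorentz_space = "(real ^ 24) \<times> real \<times> real"

fun lorentz_form :: "lorentz_space \<Rightarrow> lorentz_space \<Rightarrow> real" where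
  "lorentz_form (x, m, n) (x', m', n') = x \<bullet> x' - m * n' - m' * n"

definition lorentz_lattice :: "(real ^ 24) set \<Rightarrow> lorentz_space set" where
  "lorentz_lattice \<Lambda> = \<Lambda> \<times> \<int> \<times> \<int>"

definition roots :: "(real ^ 24) set \<Rightarrow> lorentz_space set" where
  "roots \<Lambda> = {r \<in> lorentz_lattice \<Lambda>. lorentz_form r r = 2}"

definition e :: "complex \<Rightarrow> complex" where
  "e x = exp (2 * of_real pi * \<i> * x)"

text \<open>
  The principal branch of \<open>powr\<close> on the complex numbers has \<open>Ln (-1) = \<i> * pi\<close>, which is the
  required choice of the logarithm:
\<close>

lemma neg_powr_branch:
  fixes x :: real and s :: complex
  assumes "x < 0"
  shows "complex_of_real x powr (- s) = complex_of_real \<bar>x\<bar> powr (- s) * e (- s / 2)"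
proof -
  have "Ln (complex_of_real \<bar>x\<bar>) = of_real (ln \<bar>x\<bar>)"
    using assms by (intro Ln_of_real) auto
  moreover have "Ln (complex_of_real x) = Ln (complex_of_real \<bar>x\<bar>) + \<i> * of_real pi"
    using Ln_minus[of "complex_of_real \<bar>x\<bar>"] assms by simp
  ultimately show ?thesis
    using assms by (simp add: powr_def e_def exp_add[symmetric] algebra_simps)
qed

definition E_series :: "(real ^ 24) set \<Rightarrow> lorentz_space \<Rightarrow> complex \<Rightarrow> complex" where
  "E_series \<Lambda> z s = (\<Sum>\<^sub>\<infinity>r\<in>roots \<Lambda>. complex_of_real (lorentz_form r z) powr (- s))"

text \<open>The values of \<open>\<phi>\<close> have norm \<open>-k\<close> and second coordinate \<open>h\<close>, i.e. they lie in \<open>S\<^bsub>k,h\<^esub>\<close>.\<close>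

definition \<phi> :: "real \<Rightarrow> real \<Rightarrow> real ^ 24 \<Rightarrow> lorentz_space" where
  "\<phi> k h v = (h *\<^sub>R v, h, (h\<^sup>2 * (v \<bullet> v) + k) / (2 * h))"

text \<open>
  Integrals over the torus \<open>(\<Lambda> \<otimes> \<real>) / \<Lambda>\<close> of total volume 1 are integrals of \<open>\<Lambda>\<close>-periodic functions
  over the Voronoi cell, whose translates by \<open>\<Lambda>\<close> cover the space and overlap only in null sets.
\<close>

definition voronoi_cell :: "(real ^ 'n) set \<Rightarrow> (real ^ 'n) set" where
  "voronoi_cell \<Lambda> = {v. \<forall>l\<in>\<Lambda>. norm v \<le> norm (v - l)}"

definition torus_integral :: "(real ^ 'n) set \<Rightarrow> (real ^ 'n \<Rightarrow> complex) \<Rightarrow> complex" where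
  "torus_integral \<Lambda> f =
     (LINT v:voronoi_cell \<Lambda>|lborel. f v) / complex_of_real (measure lborel (voronoi_cell \<Lambda>))"

definition fourier_coeff ::
  "(real ^ 24) set \<Rightarrow> real ^ 24 \<Rightarrow> real \<Rightarrow> real \<Rightarrow> complex \<Rightarrow> complex" where
  "fourier_coeff \<Lambda> l k h s =
     torus_integral \<Lambda> (\<lambda>v. E_series \<Lambda> (\<phi> k h v) s * e (- complex_of_real (l \<bullet> v)))"

definition fourier_coeff_star ::
  "(real ^ 24) set \<Rightarrow> real ^ 24 \<Rightarrow> real \<Rightarrow> real \<Rightarrow> complex \<Rightarrow> complex" where
  "fourier_coeff_star \<Lambda> l k h s =
     complex_of_real (h / (2 * pi)) powr s * Gamma s * fourier_coeff \<Lambda> l k h s"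

definition cong_mod_multiple :: "(real ^ 24) set \<Rightarrow> nat \<Rightarrow> ((real ^ 24) \<times> (real ^ 24)) set" where
  "cong_mod_multiple \<Lambda> n = {(x, y). x \<in> \<Lambda> \<and> y \<in> \<Lambda> \<and> (\<exists>w\<in>\<Lambda>. x - y = real n *\<^sub>R w)}"

text \<open>
  The sum runs over cosets \<open>C \<in> \<Lambda> / n\<Lambda>\<close>. For an even integral lattice and \<open>\<mu> \<in> \<Lambda>\<close>, both the condition
  on \<open>l \<bullet> l / 2\<close> and the summand are the same for all \<open>l \<in> C\<close>, so the image under the summand is
  a singleton and \<open>the_elem\<close> extracts its value.
\<close>

definition j_sum :: "(real ^ 24) set \<Rightarrow> real ^ 24 \<Rightarrow> nat \<Rightarrow> complex" where
  "j_sum \<Lambda> \<mu> n =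
     (\<Sum>C \<in> {C \<in> \<Lambda> // cong_mod_multiple \<Lambda> n. \<forall>l\<in>C. [l \<bullet> l / 2 = 1] (rmod real n)}.
        the_elem ((\<lambda>l. e (complex_of_real (l \<bullet> \<mu>) / of_nat n)) ` C))"

text \<open>The modified Bessel function of the second kind, for positive argument \<open>x\<close>.\<close>

definition Bessel_K :: "complex \<Rightarrow> real \<Rightarrow> complex" where
  "Bessel_K \<nu> x =
     (LINT t:{0..}|lborel. complex_of_real (exp (- x * cosh t)) * cosh (\<nu> * complex_of_real t))"

definition c_coeff :: "real \<Rightarrow> real \<Rightarrow> nat \<Rightarrow> real" where
  "c_coeff k h n = sqrt (k / h\<^sup>2 - 2 / (real n)\<^sup>2)"

end

theory Submission
  imports Defs "HOL-Probability.Probability"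
begin

text \<open>
  For a root \<open>r = (\<mu>; m, n)\<close> completing the square gives
  \<open>\<langle>r|\<phi>(v)\<rangle> = - (h m / 2) (|v - \<mu>/m|\<^sup>2 + c\<^sub>m\<^sup>2)\<close>, and \<open>m \<noteq> 0\<close> because the Leech lattice has no vectors of
  norm 2. The roots \<open>r\<close> and \<open>- r\<close> together contribute the factor \<open>1 + e(-s/2)\<close>. Writing
  \<open>\<mu> = m w - \<mu>\<^sub>0\<close> with \<open>w \<in> \<Lambda>\<close> and \<open>\<mu>\<^sub>0\<close> a representative of a coset of \<open>m\<Lambda>\<close>, the sum over \<open>w\<close> unfolds
  the torus integral to an integral over the whole space, where the shift by \<open>\<mu>\<^sub>0/m\<close> produces the phases
  summed in \<open>j\<^bsub>\<lambda>,m\<^esub>\<close>. The remaining Fourier transform of \<open>(|x|\<^sup>2 + c\<^sub>m\<^sup>2)\<^bsup>-s\<^esup>\<close> is a Gaussian one under the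
  Gamma integral, which leaves \<open>\<integral> t\<^bsup>s-13\<^esup> exp(- c\<^sub>m\<^sup>2 t - \<pi>\<^sup>2 \<lambda>\<^sup>2 / t) dt\<close>: a Bessel function, or a Gamma value
  for \<open>\<lambda> = 0\<close>. All interchanges are justified by absolute convergence, as there are at most \<open>m\<^bsup>24\<^esup>\<close> cosets
  and \<open>Re s > 25\<close>.
\<close>

section \<open>Unfolding over a lattice\<close>

text \<open>Without summability both sides are the default value 0.\<close>

lemma infsum_eq_integral_count_space:
  fixes f :: "'a \<Rightarrow> complex"
  shows "infsum f A = (LINT x|count_space A. f x)"
proof (cases "f summable_on A")
  case True
  then have "Infinite_Set_Sum.abs_summable_on f A"
    by (simp add: summable_on_iff_abs_summable_on_complex abs_summable_equivalent)
  then show ?thesis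
    using infsetsum_infsum[of f A] by (simp add: infsetsum_def)
next
  case False
  then have "\<not> Infinite_Set_Sum.abs_summable_on f A"
    by (simp add: summable_on_iff_abs_summable_on_complex flip: abs_summable_equivalent)
  then have "\<not> integrable (count_space A) f"
    by (simp add: abs_summable_on_def)
  with False show ?thesis
    by (simp add: infsum_not_exists not_integrable_integral_eq)
qed

lemma has_sum_integral:
  fixes f :: "'i \<Rightarrow> 'a \<Rightarrow> complex"
  assumes M: "sigma_finite_measure M" and I: "countable I"
    and meas [measurable]: "\<And>i. i \<in> I \<Longrightarrow> f i \<in> borel_measurable M"
    and fin: "(\<integral>\<^sup>+i. (\<integral>\<^sup>+x. norm (f i x) \<partial>M) \<partial>count_space I) < \<infinity>"
  shows "((\<lambda>i. LINT x|M. f i x) has_sum (LINT x|M. (\<Sum>\<^sub>\<infinity>i\<in>I. f i x))) I"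
proof -
  interpret M: sigma_finite_measure M by fact
  interpret I: sigma_finite_measure "count_space I"
    by (rule sigma_finite_measure_count_space_countable[OF I])
  interpret P: pair_sigma_finite "count_space I" M ..
  have [measurable]: "(\<lambda>(i, x). f i x) \<in> borel_measurable (count_space I \<Otimes>\<^sub>M M)"
    by (rule measurable_pair_measure_countable1[OF I]) (auto intro: meas)
  have int: "integrable (count_space I \<Otimes>\<^sub>M M) (\<lambda>(i, x). f i x)"
  proof (rule integrableI_bounded)
    have "(\<integral>\<^sup>+z. norm (case z of (i, x) \<Rightarrow> f i x) \<partial>(count_space I \<Otimes>\<^sub>M M))
        = (\<integral>\<^sup>+i. (\<integral>\<^sup>+x. norm (f i x) \<partial>M) \<partial>count_space I)"
      by (subst M.nn_integral_fst[symmetric]) auto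
    with fin show "(\<integral>\<^sup>+z. norm (case z of (i, x) \<Rightarrow> f i x) \<partial>(count_space I \<Otimes>\<^sub>M M)) < \<infinity>"
      by simp
  qed simp
  have "integrable (count_space I) (\<lambda>i. LINT x|M. f i x)"
    using P.integrable_fst'[OF int] by simp
  then have "(\<lambda>i. LINT x|M. f i x) summable_on I"
    by (simp add: summable_on_iff_abs_summable_on_complex abs_summable_equivalent
                  abs_summable_on_def)
  moreover have "(LINT x|M. (\<Sum>\<^sub>\<infinity>i\<in>I. f i x)) = (\<Sum>\<^sub>\<infinity>i\<in>I. LINT x|M. f i x)"
    unfolding infsum_eq_integral_count_space using P.Fubini_integral[of f] int by simp
  ultimately show ?thesis
    by (simp add: has_sum_infsum)
qed

lemma nn_integral_count_space_finite_of_summable: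
  fixes f :: "'a \<Rightarrow> real"
  assumes "f summable_on A" "\<And>x. x \<in> A \<Longrightarrow> f x \<ge> 0"
  shows "(\<integral>\<^sup>+x. ennreal (f x) \<partial>count_space A) < \<infinity>"
proof -
  have "(\<lambda>x. norm (f x)) summable_on A"
    using assms by (subst summable_on_cong[of _ _ f]) auto
  then have "Infinite_Set_Sum.abs_summable_on f A"
    by (simp only: abs_summable_equivalent)
  from nn_integral_conv_infsetsum[OF this assms(2)] show ?thesis
    by simp
qed

section \<open>Translations and fundamental domains\<close>

lemma nn_integral_lborel_translate:
  fixes f :: "'a::euclidean_space \<Rightarrow> ennreal"
  assumes [measurable]: "f \<in> borel_measurable borel"
  shows "(\<integral>\<^sup>+x. f (x + a) \<partial>lborel) = (\<integral>\<^sup>+x. f x \<partial>lborel)"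
proof -
  have "(\<integral>\<^sup>+x. f x \<partial>lborel) = (\<integral>\<^sup>+x. f x \<partial>distr lborel borel ((+) a))"
    by (simp add: lborel_distr_plus)
  also have "\<dots> = (\<integral>\<^sup>+x. f (a + x) \<partial>lborel)"
    by (rule nn_integral_distr) auto
  finally show ?thesis
    by (simp add: add.commute)
qed

lemma integral_lborel_translate:
  fixes f :: "'a::euclidean_space \<Rightarrow> complex"
  assumes [measurable]: "f \<in> borel_measurable borel"
  shows "(LINT x|lborel. f (x + a)) = (LINT x|lborel. f x)"
proof -
  have "(LINT x|lborel. f x) = (LINT x|distr lborel borel ((+) a). f x)"
    by (simp add: lborel_distr_plus)
  also have "\<dots> = (LINT x|lborel. f (a + x))"
    by (rule integral_distr) auto
  finally show ?thesis
    by (simp add: add.commute)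
qed

text \<open>Uniqueness is demanded only almost everywhere, because neighbouring Voronoi cells share
  boundary points.\<close>

definition fundamental_domain :: "'a::euclidean_space set \<Rightarrow> 'a set \<Rightarrow> bool" where
  "fundamental_domain L W \<longleftrightarrow> W \<in> sets borel \<and> (AE x in lborel. \<exists>!w. w \<in> L \<and> x + w \<in> W)"

text \<open>Translation by \<open>w\<close> moves the shift from \<open>g\<close> to the indicator.
  After Tonelli the inner sum counts the \<open>w\<close> with \<open>x + w\<close> in
  \<open>W\<close>, and for almost every \<open>x\<close> there is exactly one.\<close>

lemma nn_integral_unfold:
  fixes L :: "'a::euclidean_space set"
  assumes W: "fundamental_domain L W" and L: "countable L"
    and [measurable]: "g \<in> borel_measurable borel"
  shows "(\<integral>\<^sup>+w. (\<integral>\<^sup>+x. g (x - w) * indicator W x \<partial>lborel) \<partial>count_space L) = (\<integral>\<^sup>+x. g x \<partial>lborel)"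
proof -
  have [measurable]: "W \<in> sets borel"
    using W by (simp add: fundamental_domain_def)
  have "(\<integral>\<^sup>+x. g (x - w) * indicator W x \<partial>lborel) = (\<integral>\<^sup>+x. g x * indicator W (x + w) \<partial>lborel)" for w
    using nn_integral_lborel_translate[of "\<lambda>x. g (x - w) * indicator W x" w] by simp
  then have "(\<integral>\<^sup>+w. (\<integral>\<^sup>+x. g (x - w) * indicator W x \<partial>lborel) \<partial>count_space L)
      = (\<integral>\<^sup>+w. (\<integral>\<^sup>+x. g x * indicator W (x + w) \<partial>lborel) \<partial>count_space L)"
    by simp
  also have "\<dots> = (\<integral>\<^sup>+x. (\<integral>\<^sup>+w. g x * indicator W (x + w) \<partial>count_space L) \<partial>lborel)"
    by (rule nn_integral_count_space_nn_integral[symmetric, OF L]) simp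
  also have "\<dots> = (\<integral>\<^sup>+x. g x \<partial>lborel)"
  proof (rule nn_integral_cong_AE)
    have "AE x in lborel. \<exists>!w. w \<in> L \<and> x + w \<in> W"
      using W by (simp add: fundamental_domain_def)
    then show "AE x in lborel. (\<integral>\<^sup>+w. g x * indicator W (x + w) \<partial>count_space L) = g x"
    proof eventually_elim
      case (elim x)
      then obtain u where u: "u \<in> L" "x + u \<in> W" "\<And>w. w \<in> L \<Longrightarrow> x + w \<in> W \<Longrightarrow> w = u"
        by blast
      have "x + w \<in> W \<longleftrightarrow> w = u" if "w \<in> L" for w
        using u that by blast
      then have "(\<integral>\<^sup>+w. g x * indicator W (x + w) \<partial>count_space L)
          = (\<integral>\<^sup>+w. g x * indicator {u} w \<partial>count_space L)"
        by (intro nn_integral_cong) (simp add: indicator_def)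
      also have "\<dots> = g x"
        using u(1) by (subst nn_integral_cmult_indicator) auto
      finally show ?case .
    qed
  qed
  finally show ?thesis .
qed

text \<open>Unfolding the indicator of \<open>V\<close> over \<open>W\<close> writes the volume of
  \<open>V\<close> as the sum of the volumes of \<open>(V + w) \<inter> W\<close>. A translation and
  the reflection of \<open>w\<close> to \<open>- w\<close> exchange the two sets. The volume of the
  Voronoi cell can thus be computed from a parallelepiped.\<close>

lemma emeasure_fundamental_domain_eq:
  fixes L :: "'a::euclidean_space set"
  assumes V: "fundamental_domain L V" and W: "fundamental_domain L W" and L: "countable L"
    and neg: "\<And>w. w \<in> L \<Longrightarrow> - w \<in> L"
  shows "emeasure lborel V = emeasure lborel W"
proof -
  have [measurable]: "V \<in> sets borel" "W \<in> sets borel"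
    using V W by (auto simp: fundamental_domain_def)
  have "emeasure lborel V
      = (\<integral>\<^sup>+w. (\<integral>\<^sup>+x. indicator V (x - w) * indicator W x \<partial>lborel) \<partial>count_space L)"
    using nn_integral_unfold[OF W L, of "indicator V"] by simp
  also have "\<dots> = (\<integral>\<^sup>+w. (\<integral>\<^sup>+x. indicator W (x - (- w)) * indicator V x \<partial>lborel) \<partial>count_space L)"
  proof (rule nn_integral_cong)
    fix w
    show "(\<integral>\<^sup>+x. indicator V (x - w) * indicator W x \<partial>lborel)
        = (\<integral>\<^sup>+x. indicator W (x - (- w)) * indicator V x \<partial>lborel)"
      using nn_integral_lborel_translate[of "\<lambda>x. indicator V (x - w) * indicator W x" w]
      by (simp add: mult.commute)
  qed
  also have "\<dots> = (\<integral>\<^sup>+w. (\<integral>\<^sup>+x. indicator W (x - w) * indicator V x \<partial>lborel) \<partial>count_space L)"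
  proof (rule nn_integral_bij_count_space)
    show "bij_betw uminus L L"
      by (rule bij_betwI[of _ _ _ uminus]) (use neg in auto)
  qed
  also have "\<dots> = emeasure lborel W"
    using nn_integral_unfold[OF V L, of "indicator W"] by simp
  finally show ?thesis .
qed

text \<open>The index \<open>j\<close> stays outside the unfolding, so the only bound to be checked
  is on the sum over \<open>J\<close> of the L1 norms over the whole space. The nonnegative
  unfolding turns this into the absolute bound over \<open>J \<times> L\<close> that justifies the
  interchange.\<close>

lemma has_sum_unfold:
  fixes L :: "'a::euclidean_space set" and G :: "'j \<Rightarrow> 'a \<Rightarrow> complex"
  assumes W: "fundamental_domain L W" and L: "countable L" and J: "countable J"
    and meas: "\<And>j. j \<in> J \<Longrightarrow> G j \<in> borel_measurable borel"
    and fin: "(\<integral>\<^sup>+j. (\<integral>\<^sup>+x. norm (G j x) \<partial>lborel) \<partial>count_space J) < \<infinity>"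
  shows "((\<lambda>j. LINT x|lborel. G j x) has_sum
           (LINT x:W|lborel. (\<Sum>\<^sub>\<infinity>(j, w)\<in>J \<times> L. G j (x - w)))) J"
proof -
  have Wm [measurable]: "W \<in> sets borel"
    using W by (simp add: fundamental_domain_def)
  note meas [measurable]
  define F where "F = (\<lambda>(j, w) x. indicat_real W x *\<^sub>R G j (x - w))"
  \<comment> \<open>After the translation the shift by \<open>w\<close> sits in the indicator alone,
    so a sum over \<open>w\<close> only counts translates.\<close>
  have swap: "(LINT x|lborel. F (j, w) x) = (LINT x|lborel. indicat_real W (x + w) *\<^sub>R G j x)"
    if [measurable]: "j \<in> J" for j w
    using integral_lborel_translate[of "\<lambda>x. indicat_real W x *\<^sub>R G j (x - w)" w]
    by (simp add: F_def)
  have nF: "(\<integral>\<^sup>+w. (\<integral>\<^sup>+x. norm (F (j, w) x) \<partial>lborel) \<partial>count_space L)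
              = (\<integral>\<^sup>+x. norm (G j x) \<partial>lborel)" if [measurable]: "j \<in> J" for j
  proof -
    have "(\<integral>\<^sup>+w. (\<integral>\<^sup>+x. norm (F (j, w) x) \<partial>lborel) \<partial>count_space L)
      = (\<integral>\<^sup>+w. (\<integral>\<^sup>+x. ennreal (norm (G j (x - w))) * indicator W x \<partial>lborel) \<partial>count_space L)"
      by (intro nn_integral_cong) (auto simp: F_def split: split_indicator)
    also have "\<dots> = (\<integral>\<^sup>+x. norm (G j x) \<partial>lborel)"
      by (rule nn_integral_unfold[OF W L]) simp
    finally show ?thesis .
  qed
  have "(\<integral>\<^sup>+i. (\<integral>\<^sup>+x. norm (F i x) \<partial>lborel) \<partial>count_space (J \<times> L))
      = (\<integral>\<^sup>+j. (\<integral>\<^sup>+w. (\<integral>\<^sup>+x. norm (F (j, w) x) \<partial>lborel) \<partial>count_space L) \<partial>count_space J)"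
  proof -
    interpret L: sigma_finite_measure "count_space L"
      by (rule sigma_finite_measure_count_space_countable[OF L])
    show ?thesis
      by (subst pair_measure_countable[OF J L, symmetric], subst L.nn_integral_fst[symmetric])
         (auto simp: pair_measure_countable[OF J L])
  qed
  also have "\<dots> = (\<integral>\<^sup>+j. (\<integral>\<^sup>+x. norm (G j x) \<partial>lborel) \<partial>count_space J)"
    by (intro nn_integral_cong) (simp add: nF)
  finally have finF: "(\<integral>\<^sup>+i. (\<integral>\<^sup>+x. norm (F i x) \<partial>lborel) \<partial>count_space (J \<times> L)) < \<infinity>"
    using fin by simp
  have "((\<lambda>i. LINT x|lborel. F i x) has_sum (LINT x|lborel. (\<Sum>\<^sub>\<infinity>i\<in>J \<times> L. F i x))) (J \<times> L)"
  proof (rule has_sum_integral)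
    show "countable (J \<times> L)"
      using J L by simp
    show "F i \<in> borel_measurable lborel" if "i \<in> J \<times> L" for i
    proof -
      have [measurable]: "fst i \<in> J"
        using that by auto
      show ?thesis
        by (simp add: F_def case_prod_beta)
    qed
  qed (fact sigma_finite_lborel finF)+
  \<comment> \<open>For fixed \<open>j\<close> the sum over \<open>w\<close> restores the
    whole-space integral, as almost every \<open>x\<close> has a single translate in
    \<open>W\<close>. With this inner sum \<open>has_sum_SigmaD\<close> collapses the sum over pairs
    to one over \<open>J\<close>.\<close>
  moreover have "((\<lambda>w. LINT x|lborel. F (j, w) x) has_sum (LINT x|lborel. G j x)) L"
    if j [measurable]: "j \<in> J" for j
  proof -
    have finj: "(\<integral>\<^sup>+x. norm (G j x) \<partial>lborel) < \<infinity>"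
    proof -
      have "(\<integral>\<^sup>+x. norm (G j x) \<partial>lborel) =
            (\<integral>\<^sup>+i. (\<integral>\<^sup>+x. norm (G i x) \<partial>lborel) * indicator {j} i \<partial>count_space J)"
        using j by (subst nn_integral_indicator_singleton) auto
      also have "\<dots> \<le> (\<integral>\<^sup>+i. (\<integral>\<^sup>+x. norm (G i x) \<partial>lborel) \<partial>count_space J)"
        by (intro nn_integral_mono) (auto split: split_indicator)
      also have "\<dots> < \<infinity>" by fact
      finally show ?thesis .
    qed
    have "((\<lambda>w. LINT x|lborel. indicat_real W (x + w) *\<^sub>R G j x) has_sum
             (LINT x|lborel. (\<Sum>\<^sub>\<infinity>w\<in>L. indicat_real W (x + w) *\<^sub>R G j x))) L"
    proof (rule has_sum_integral)
      have "(\<integral>\<^sup>+x. norm (indicat_real W (x + w) *\<^sub>R G j x) \<partial>lborel)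
          = (\<integral>\<^sup>+x. norm (F (j, w) x) \<partial>lborel)" for w
        using nn_integral_lborel_translate[of "\<lambda>x. norm (F (j, w) x)" w]
        by (simp add: F_def)
      then show "(\<integral>\<^sup>+w. (\<integral>\<^sup>+x. norm (indicat_real W (x + w) *\<^sub>R G j x) \<partial>lborel) \<partial>count_space L) < \<infinity>"
        using nF[OF j] finj by simp
    qed (simp_all add: L sigma_finite_lborel)
    also have "(LINT x|lborel. (\<Sum>\<^sub>\<infinity>w\<in>L. indicat_real W (x + w) *\<^sub>R G j x)) = (LINT x|lborel. G j x)"
    proof (rule integral_cong_AE)
      show "(\<lambda>x. \<Sum>\<^sub>\<infinity>w\<in>L. indicat_real W (x + w) *\<^sub>R G j x) \<in> borel_measurable lborel"
        unfolding infsum_eq_integral_count_space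
      proof (rule sigma_finite_measure.borel_measurable_lebesgue_integral)
        show "(\<lambda>(x, w). indicat_real W (x + w) *\<^sub>R G j x) \<in> borel_measurable (lborel \<Otimes>\<^sub>M count_space L)"
          by (subst measurable_pair_swap_iff)
             (rule measurable_pair_measure_countable1[OF L], use j in simp)
      qed (rule sigma_finite_measure_count_space_countable[OF L])
      have "AE x in lborel. \<exists>!w. w \<in> L \<and> x + w \<in> W"
        using W by (simp add: fundamental_domain_def)
      then show "AE x in lborel. (\<Sum>\<^sub>\<infinity>w\<in>L. indicat_real W (x + w) *\<^sub>R G j x) = G j x"
      proof eventually_elim
        case (elim x)
        then obtain u where u: "u \<in> L" "x + u \<in> W" "\<And>w. w \<in> L \<Longrightarrow> x + w \<in> W \<Longrightarrow> w = u"
          by blast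
        have "(\<Sum>\<^sub>\<infinity>w\<in>L. indicat_real W (x + w) *\<^sub>R G j x) = (\<Sum>\<^sub>\<infinity>w\<in>{u}. G j x)"
        proof (rule infsum_cong_neutral)
          fix w assume "w \<in> L - {u}"
          then have "x + w \<notin> W"
            using u(3) by blast
          then show "indicat_real W (x + w) *\<^sub>R G j x = 0"
            by simp
        qed (use u(1,2) in auto)
        then show ?case by simp
      qed
    qed (use j in measurable)
    finally show ?thesis
      using swap[OF j] by simp
  qed
  ultimately have "((\<lambda>j. LINT x|lborel. G j x) has_sum (LINT x|lborel. (\<Sum>\<^sub>\<infinity>i\<in>J \<times> L. F i x))) J"
    by (rule has_sum_SigmaD)
  also have "(LINT x|lborel. (\<Sum>\<^sub>\<infinity>i\<in>J \<times> L. F i x))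
      = (LINT x:W|lborel. (\<Sum>\<^sub>\<infinity>(j, w)\<in>J \<times> L. G j (x - w)))"
    unfolding set_lebesgue_integral_def
  proof (intro Bochner_Integration.integral_cong refl)
    fix x
    show "(\<Sum>\<^sub>\<infinity>i\<in>J \<times> L. F i x) = indicat_real W x *\<^sub>R (\<Sum>\<^sub>\<infinity>(j, w)\<in>J \<times> L. G j (x - w))"
      by (cases "x \<in> W") (simp_all add: F_def case_prod_unfold)
  qed
  finally show ?thesis .
qed

section \<open>Lattices and Voronoi cells\<close>

lemma matrix_inv_mult:
  fixes B :: "real ^ 'n ^ 'n"
  assumes "invertible B"
  shows "B ** matrix_inv B = mat 1" "matrix_inv B ** B = mat 1"
proof -
  from assms have "\<exists>C. B ** C = mat 1 \<and> C ** B = mat 1"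
    unfolding invertible_def by blast
  then have "B ** matrix_inv B = mat 1 \<and> matrix_inv B ** B = mat 1"
    unfolding matrix_inv_def by (rule someI_ex)
  then show "B ** matrix_inv B = mat 1" "matrix_inv B ** B = mat 1"
    by auto
qed

lemma Ints_det:
  fixes A :: "real ^ 'n ^ 'n"
  assumes "\<And>i j. A $ i $ j \<in> \<int>"
  shows "det A \<in> \<int>"
  unfolding det_def by (intro Ints_sum Ints_mult Ints_prod assms Ints_of_int)

lemma transpose_mult_component: "(transpose A ** A) $ i $ j = column i A \<bullet> column j A"
  for A :: "real ^ 'n ^ 'm"
  by (simp add: matrix_matrix_mult_def transpose_def column_def inner_vec_def)

text \<open>The basis and its dual basis both lie in \<open>L\<close>, so both Gram matrices are
  integral. Their determinants are the squares of \<open>det B\<close> and \<open>det D\<close>, two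
  integers with product 1.\<close>

lemma full_lattice_self_dual_det:
  fixes B :: "real ^ 'n ^ 'n"
  assumes B: "invertible B" and L: "L = {B *v x | x. \<forall>i. x $ i \<in> \<int>}" and dual: "dual_lattice L = L"
  shows "\<bar>det B\<bar> = 1"
proof -
  define D where "D = transpose (matrix_inv B)"
  have ip: "x \<bullet> y \<in> \<int>" if "x \<in> L" "y \<in> L" for x y
    using that dual by (auto simp: dual_lattice_def)
  have "column i B \<in> L" for i
    unfolding L by (auto simp: axis_def simp flip: matrix_vector_mult_basis intro!: exI[of _ "axis i 1"])
  then have "det (transpose B ** B) \<in> \<int>"
    by (intro Ints_det) (auto simp: transpose_mult_component ip)
  \<comment> \<open>The columns of the inverse transpose form the dual basis: pairing column
    \<open>i\<close> with \<open>B *v z\<close> picks out the integer \<open>z $ i\<close>.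
    Self-duality brings these columns back into \<open>L\<close>.\<close>
  moreover have "column i D \<in> L" for i
  proof -
    have "column i D \<bullet> (B *v z) = z $ i" for z
    proof -
      have "column i D \<bullet> (B *v z) = (matrix_inv B *v (B *v z)) $ i"
        by (simp add: D_def column_def transpose_def matrix_vector_mult_def[of "matrix_inv B"] inner_vec_def)
      also have "\<dots> = z $ i"
        by (simp add: matrix_vector_mul_assoc matrix_inv_mult[OF B])
      finally show ?thesis .
    qed
    then have "column i D \<in> dual_lattice L"
      by (auto simp: dual_lattice_def L)
    with dual show ?thesis by simp
  qed
  then have "det (transpose D ** D) \<in> \<int>"
    by (intro Ints_det) (auto simp: transpose_mult_component ip)
  moreover have "det B * det D = 1"
    using det_mul[of B "matrix_inv B"] by (simp add: matrix_inv_mult[OF B] D_def)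
  ultimately have I: "(det B)\<^sup>2 \<in> \<int>" "(det D)\<^sup>2 \<in> \<int>" and eq: "(det B)\<^sup>2 * (det D)\<^sup>2 = 1"
    by (simp_all add: det_mul power2_eq_square mult.assoc mult.left_commute mult.commute[of "det D" "det B"])
  obtain a b :: int where ab: "(det B)\<^sup>2 = of_int a" "(det D)\<^sup>2 = of_int b"
    using I by (auto elim!: Ints_cases)
  then have "of_int (a * b) = (1::real)"
    using eq by simp
  then have "a * b = 1"
    by (simp only: of_int_eq_1_iff)
  moreover have "a \<ge> 0"
    using zero_le_power2[of "det B"] unfolding ab by simp
  ultimately have "a = 1"
    using zmult_eq_1_iff by auto
  then have "(det B)\<^sup>2 = 1"
    using ab by simp
  then show ?thesis
    by (auto simp: power2_eq_1_iff)
qed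

section \<open>Lattices as countable closed groups, and their parallelepipeds\<close>

lemma countable_full_lattice:
  fixes L :: "(real ^ 'n) set"
  assumes "full_lattice L"
  shows "countable L"
proof -
  obtain B :: "real ^ 'n ^ 'n" where L: "L = {B *v x | x. \<forall>i. x $ i \<in> \<int>}"
    using assms by (auto simp: full_lattice_def)
  have "L \<subseteq> (\<lambda>f. B *v (\<chi> i. of_int (f i))) ` (UNIV :: ('n \<Rightarrow> int) set)"
  proof
    fix y assume "y \<in> L"
    then obtain x where y: "y = B *v x" and x: "\<forall>i. x $ i \<in> \<int>"
      by (auto simp: L)
    from x have "x = (\<chi> i. of_int \<lfloor>x $ i\<rfloor>)"
      by (simp add: vec_eq_iff of_int_floor_cancel)
    with y show "y \<in> (\<lambda>f. B *v (\<chi> i. of_int (f i))) ` (UNIV :: ('n \<Rightarrow> int) set)"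
      by (intro image_eqI[of _ _ "\<lambda>i. \<lfloor>x $ i\<rfloor>"]) auto
  qed
  moreover have "countable (UNIV :: ('n \<Rightarrow> int) set)"
    by simp
  ultimately show ?thesis
    by (meson countable_image countable_subset)
qed

text \<open>Closedness supplies a lattice point nearest to any given point, as the Voronoi cell
  requires. The lattice is the image of the closed set of integer vectors under an injective linear
  map.\<close>

lemma closed_full_lattice:
  fixes L :: "(real ^ 'n) set"
  assumes "full_lattice L"
  shows "closed L"
proof -
  obtain B :: "real ^ 'n ^ 'n" where B: "invertible B" and L: "L = {B *v x | x. \<forall>i. x $ i \<in> \<int>}"
    using assms by (auto simp: full_lattice_def)
  have "closed {x :: real ^ 'n. \<forall>i. x $ i \<in> \<int>}"
  proof (rule closed_Collect_all)
    fix i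
    have "closed ((\<lambda>x :: real ^ 'n. x $ i) -` \<int>)"
      by (rule continuous_closed_vimage) (auto intro!: continuous_intros)
    then show "closed {x :: real ^ 'n. x $ i \<in> \<int>}"
      by (simp add: vimage_def)
  qed
  moreover have "inj ((*v) B)"
    using B inj_matrix_vector_mult by blast
  ultimately have "closed ((*v) B ` {x. \<forall>i. x $ i \<in> \<int>})"
    by (intro closed_injective_linear_image) auto
  then show ?thesis
    by (simp add: L image_Collect)
qed

lemma
  fixes L :: "(real ^ 'n) set"
  assumes "full_lattice L"
  shows full_lattice_0: "0 \<in> L"
    and full_lattice_add: "x \<in> L \<Longrightarrow> y \<in> L \<Longrightarrow> x + y \<in> L"
    and full_lattice_uminus: "x \<in> L \<Longrightarrow> - x \<in> L"
    and full_lattice_diff: "x \<in> L \<Longrightarrow> y \<in> L \<Longrightarrow> x - y \<in> L"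
proof -
  obtain B :: "real ^ 'n ^ 'n" where L: "L = {B *v x | x. \<forall>i. x $ i \<in> \<int>}"
    using assms by (auto simp: full_lattice_def)
  show z: "0 \<in> L"
    unfolding L by (auto intro!: exI[of _ 0])
  show d: "x - y \<in> L" if "x \<in> L" "y \<in> L" for x y
  proof -
    from that obtain a b where "x = B *v a" "y = B *v b" "\<forall>i. a $ i \<in> \<int>" "\<forall>i. b $ i \<in> \<int>"
      by (auto simp: L)
    then show ?thesis
      unfolding L by (auto intro!: exI[of _ "a - b"] simp: matrix_vector_mult_diff_distrib)
  qed
  show u: "- x \<in> L" if "x \<in> L" for x
    using d[OF z that] by simp
  show "x + y \<in> L" if "x \<in> L" "y \<in> L"
    using d[OF that(1) u[OF that(2)]] by simp
qed

lemma full_lattice_scaleR_nat: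
  fixes L :: "(real ^ 'n) set"
  assumes "full_lattice L" "x \<in> L"
  shows "real m *\<^sub>R x \<in> L"
  by (induction m) (auto simp: scaleR_add_left assms full_lattice_0 full_lattice_add)

text \<open>In the coordinates of the basis \<open>B\<close>, every real number has exactly one
  integer translate in the half-open unit interval. This fundamental domain links the covolume of
  \<open>L\<close> with \<open>det B\<close>.\<close>

lemma fundamental_domain_parallelepiped:
  fixes B :: "real ^ ('n::{finite,wellorder}) ^ ('n::{finite,wellorder})"
  assumes B: "invertible B" and L: "L = {B *v x | x. \<forall>i. x $ i \<in> \<int>}"
  defines "P \<equiv> {B *v x | x. \<forall>i. 0 \<le> x $ i \<and> x $ i < 1}"
  shows "fundamental_domain L P" and "emeasure lborel P = ennreal \<bar>det B\<bar>"
proof -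
  note inv = matrix_inv_mult[OF B]
  define C where "C = {x :: real ^ ('n::{finite,wellorder}). \<forall>i. 0 \<le> x $ i \<and> x $ i < 1}"
  have C [measurable]: "C \<in> sets borel"
  proof -
    have "{x \<in> space borel. \<forall>i. 0 \<le> x $ i \<and> x $ i < 1} \<in> sets (borel :: (real ^ ('n::{finite,wellorder})) measure)"
      by measurable
    then show ?thesis by (simp add: C_def)
  qed
  have PC: "P = (*v) B ` C"
    by (auto simp: P_def C_def)
  \<comment> \<open>The preimage form gives measurability and the membership test; the image form
    gives the volume under a linear map.\<close>
  have PC': "P = (*v) (matrix_inv B) -` C"
  proof (intro set_eqI iffI)
    fix y assume "y \<in> P"
    then show "y \<in> (*v) (matrix_inv B) -` C"
      by (auto simp: PC matrix_vector_mul_assoc inv)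
  next
    fix y assume "y \<in> (*v) (matrix_inv B) -` C"
    moreover have "y = B *v (matrix_inv B *v y)"
      by (simp add: matrix_vector_mul_assoc inv)
    ultimately show "y \<in> P"
      unfolding PC by blast
  qed
  have "(*v) (matrix_inv B) \<in> borel_measurable borel"
    by (intro borel_measurable_continuous_onI continuous_intros)
  from measurable_sets[OF this C] have P: "P \<in> sets borel"
    by (simp add: PC')
  have "\<exists>!w. w \<in> L \<and> x + w \<in> P" for x
  proof -
    define y where "y = matrix_inv B *v x"
    have x: "x = B *v y"
      by (simp add: y_def matrix_vector_mul_assoc inv)
    have mem: "x + B *v z \<in> P \<longleftrightarrow> y + z \<in> C" for z
      by (simp add: PC' y_def matrix_vector_right_distrib matrix_vector_mul_assoc inv)
    show ?thesis
    proof (rule ex1I)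
      \<comment> \<open>Subtracting the floors leaves the fractional parts of the coordinates of
        \<open>x\<close>.\<close>
      let ?w = "B *v (\<chi> i. - of_int \<lfloor>y $ i\<rfloor>)"
      show "?w \<in> L \<and> x + ?w \<in> P"
        unfolding mem by (auto simp: L C_def intro!: exI[of _ "\<chi> i. - of_int \<lfloor>y $ i\<rfloor>"]) linarith
      fix w assume w: "w \<in> L \<and> x + w \<in> P"
      then obtain z where z: "w = B *v z" "\<forall>i. z $ i \<in> \<int>"
        by (auto simp: L)
      have "z $ i = - of_int \<lfloor>y $ i\<rfloor>" for i
      proof -
        obtain n :: int where n: "z $ i = of_int n"
          using z(2) by (metis Ints_cases)
        have "0 \<le> y $ i + z $ i" "y $ i + z $ i < 1"
          using w unfolding z mem by (auto simp: C_def)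
        then have "\<lfloor>y $ i\<rfloor> = - n"
          unfolding n by (intro floor_unique) auto
        with n show ?thesis by simp
      qed
      then have "z = (\<chi> i. - of_int \<lfloor>y $ i\<rfloor>)"
        by (simp add: vec_eq_iff)
      with z show "w = ?w" by simp
    qed
  qed
  with P show "fundamental_domain L P"
    by (simp add: fundamental_domain_def)
  have one: "(\<Prod>b\<in>Basis. ((1 :: real ^ ('n::{finite,wellorder})) - 0) \<bullet> b) = 1"
    by (intro prod.neutral) (auto simp: Basis_vec_def inner_axis)
  \<comment> \<open>The half-open cube is squeezed between the open and the closed unit cube, both
    of volume 1.\<close>
  have "emeasure lborel (box 0 1 :: (real ^ ('n::{finite,wellorder})) set) \<le> emeasure lborel C"
    by (intro emeasure_mono) (auto simp: mem_box_cart C_def less_imp_le)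
  moreover have "emeasure lborel C \<le> emeasure lborel (cbox 0 1 :: (real ^ ('n::{finite,wellorder})) set)"
    by (intro emeasure_mono) (auto simp: mem_box_cart C_def less_imp_le)
  moreover have "emeasure lborel (box 0 1 :: (real ^ ('n::{finite,wellorder})) set) = 1"
    "emeasure lborel (cbox 0 1 :: (real ^ ('n::{finite,wellorder})) set) = 1"
    using one by (auto simp: emeasure_lborel_box_eq emeasure_lborel_cbox_eq Basis_vec_def inner_axis)
  ultimately have eC: "emeasure lborel C = 1"
    by simp
  have "C \<in> lmeasurable"
    by (intro fmeasurableI) (auto simp: eC emeasure_completion)
  then have lm: "P \<in> lmeasurable" "measure lebesgue P = \<bar>det B\<bar> * measure lebesgue C"
    using measurable_linear_image[of "(*v) B" C] measure_linear_image[of "(*v) B" C] by (auto simp: PC)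
  have "emeasure lborel P = emeasure lebesgue P"
    using P by simp
  also have "\<dots> = ennreal (measure lebesgue P)"
    using lm(1) by (rule emeasure_eq_measure2)
  also have "measure lebesgue P = \<bar>det B\<bar>"
  proof -
    have "measure lebesgue C = 1"
      using eC by (simp add: measure_def)
    with lm(2) show ?thesis by (simp only:)
  qed
  finally show "emeasure lborel P = ennreal \<bar>det B\<bar>" .
qed

section \<open>Voronoi cells\<close>

lemma closed_voronoi_cell: "closed (voronoi_cell L)"
proof -
  have "voronoi_cell L = (\<Inter>l\<in>L. {v. norm v \<le> norm (v - l)})"
    by (auto simp: voronoi_cell_def)
  then show ?thesis
    by (auto intro!: closed_INT closed_Collect_le continuous_intros)
qed

text \<open>The point \<open>x + w\<close> lies in the cell exactly when \<open>w\<close> is a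
  lattice point nearest to \<open>- x\<close>. Such a point exists because \<open>L\<close> is
  closed, and it is unique unless two lattice points are equally far away, which confines
  \<open>x\<close> to countably many hyperplanes.\<close>

lemma fundamental_domain_voronoi_cell:
  fixes L :: "(real ^ 'n) set"
  assumes L: "full_lattice L"
  shows "fundamental_domain L (voronoi_cell L)"
proof -
  have cnt: "countable L"
    by (rule countable_full_lattice[OF L])
  have null: "AE x in lborel. norm (x + u) \<noteq> norm (x + w)" if "u \<noteq> w" for u w :: "real ^ 'n"
  proof -
    \<comment> \<open>The squared norms differ by an affine function of \<open>x\<close> with
      nonzero gradient, so ties form a hyperplane.\<close>
    have "norm (x + u) = norm (x + w) \<longleftrightarrow> (2 *\<^sub>R (u - w)) \<bullet> x = w \<bullet> w - u \<bullet> u" for x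
      unfolding norm_eq by (auto simp: algebra_simps inner_commute)
    then have "{x. norm (x + u) = norm (x + w)} = {x. (2 *\<^sub>R (u - w)) \<bullet> x = w \<bullet> w - u \<bullet> u}"
      by simp
    moreover have "negligible {x. (2 *\<^sub>R (u - w)) \<bullet> x = w \<bullet> w - u \<bullet> u}"
      using that by (intro negligible_hyperplane) auto
    ultimately have "{x. norm (x + u) = norm (x + w)} \<in> null_sets lebesgue"
      by (simp add: negligible_iff_null_sets)
    then have "AE x in lebesgue. x \<notin> {x. norm (x + u) = norm (x + w)}"
      by (rule AE_not_in)
    then show ?thesis
      by (simp add: AE_completion_iff)
  qed
  \<comment> \<open>Countability of \<open>L\<close> allows all pairs to be excluded at
    once.\<close>
  have "AE x in lborel. \<forall>u\<in>L. \<forall>w\<in>L. u \<noteq> w \<longrightarrow> norm (x + u) \<noteq> norm (x + w)"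
    unfolding AE_ball_countable[OF cnt] by (intro ballI AE_impI null)
  then have "AE x in lborel. \<exists>!w. w \<in> L \<and> x + w \<in> voronoi_cell L"
  proof eventually_elim
    case (elim x)
    have "closed L" "L \<noteq> {}"
      using closed_full_lattice[OF L] full_lattice_0[OF L] by auto
    then obtain u where u: "u \<in> L" "\<And>w. w \<in> L \<Longrightarrow> dist (- x) u \<le> dist (- x) w"
      using distance_attains_inf[of L "- x"] by blast
    have d: "dist (- x) w = norm (x + w)" for w
      by (metis add_uminus_conv_diff dist_norm minus_add_distrib norm_minus_cancel)
    show ?case
    proof (rule ex1I)
      show "u \<in> L \<and> x + u \<in> voronoi_cell L"
        using u full_lattice_diff[OF L] by (auto simp: voronoi_cell_def d add_diff_eq[symmetric])
      fix w assume w: "w \<in> L \<and> x + w \<in> voronoi_cell L"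
      then have "norm (x + w) \<le> norm (x + w - (w - u))"
        using u(1) full_lattice_diff[OF L, of w u] by (auto simp: voronoi_cell_def)
      then have "norm (x + w) \<le> norm (x + u)"
        by simp
      moreover have "norm (x + u) \<le> norm (x + w)"
        using u(2)[of w] w by (simp add: d)
      ultimately show "w = u"
        using elim u(1) w by force
    qed
  qed
  then show ?thesis
    by (simp add: fundamental_domain_def closed_voronoi_cell borel_closed)
qed

lemma measure_voronoi_cell_self_dual:
  fixes L :: "(real ^ ('n::{finite,wellorder})) set"
  assumes L: "full_lattice L" and dual: "dual_lattice L = L"
  shows "measure lborel (voronoi_cell L) = 1"
proof -
  obtain B :: "real ^ ('n::{finite,wellorder}) ^ ('n::{finite,wellorder})" where B: "invertible B" "L = {B *v x | x. \<forall>i. x $ i \<in> \<int>}"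
    using L by (auto simp: full_lattice_def)
  have "emeasure lborel (voronoi_cell L) = emeasure lborel {B *v x | x. \<forall>i. 0 \<le> x $ i \<and> x $ i < 1}"
    by (rule emeasure_fundamental_domain_eq[OF fundamental_domain_voronoi_cell[OF L]
          fundamental_domain_parallelepiped(1)[OF B] countable_full_lattice[OF L]])
       (rule full_lattice_uminus[OF L])
  also have "\<dots> = 1"
    using fundamental_domain_parallelepiped(2)[OF B] full_lattice_self_dual_det[OF B dual] by simp
  finally show ?thesis
    by (simp add: measure_def)
qed

section \<open>Fourier transform of an inverse power\<close>

lemma e_add: "e (x + y) = e x * e y"
  by (simp add: e_def exp_add[symmetric] algebra_simps)

lemma e_of_real: "e (of_real x) = exp (\<i> * of_real (2 * pi * x))"
  by (simp add: e_def mult_ac)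

lemma e_of_int [simp]: "e (of_int n) = 1"
  by (simp add: e_def exp_eq_1)

lemma e_nonzero [simp]: "e z \<noteq> 0"
  by (simp add: e_def)

lemma norm_e_of_real [simp]: "norm (e (of_real x)) = 1"
  by (simp add: e_of_real)

lemma e_sum: "finite A \<Longrightarrow> e (\<Sum>i\<in>A. f i) = (\<Prod>i\<in>A. e (f i))"
  by (induction A rule: finite_induct) (simp_all add: e_add, simp add: e_def)

lemma continuous_on_e [continuous_intros]: "continuous_on S f \<Longrightarrow> continuous_on S (\<lambda>x. e (f x))"
  unfolding e_def by (intro continuous_intros)

lemma borel_measurable_e [measurable]: "e \<in> borel_measurable borel"
  by (intro borel_measurable_continuous_onI continuous_intros)

text \<open>This is the characteristic function of the standard normal distribution after a
  rescaling and removal of the factor \<open>sqrt (2 * pi)\<close>.\<close>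

lemma gaussian_fourier_real:
  fixes t a :: real
  assumes t: "t > 0"
  shows "has_bochner_integral lborel (\<lambda>x. of_real (exp (- t * x\<^sup>2)) * e (of_real (a * x)))
           (of_real (sqrt (pi / t) * exp (- pi\<^sup>2 * a\<^sup>2 / t)))"
proof -
  \<comment> \<open>The scale \<open>c\<close> turns the normal exponent into
    \<open>- t * x\<^sup>2\<close>, and \<open>u\<close> is chosen so that
    \<open>u * (c * x) = 2 * pi * a * x\<close>.\<close>
  define c where "c = sqrt (2 * t)"
  define u where "u = 2 * pi * a / c"
  have c: "c > 0" "c\<^sup>2 = 2 * t"
    using t by (auto simp: c_def)
  have 1: "has_bochner_integral lborel (\<lambda>x. std_normal_density x *\<^sub>R exp (\<i> * of_real (u * x)))
          (of_real (exp (- u\<^sup>2 / 2)))"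
  proof -
    have "integrable lborel (\<lambda>x. std_normal_density x *\<^sub>R exp (\<i> * of_real (u * x)))"
    proof (rule Bochner_Integration.integrable_bound)
      show "integrable lborel std_normal_density"
        by simp
    qed auto
    moreover have "(LINT x|lborel. std_normal_density x *\<^sub>R exp (\<i> * of_real (u * x)))
        = char std_normal_distribution u"
      unfolding char_def by (subst integral_density) auto
    ultimately show ?thesis
      by (simp add: has_bochner_integral_iff char_std_normal_distribution)
  qed
  have "has_bochner_integral lborel (\<lambda>x. std_normal_density (0 + c * x) *\<^sub>R exp (\<i> * of_real (u * (0 + c * x))))
          (of_real (exp (- u\<^sup>2 / 2)) /\<^sub>R \<bar>c\<bar>)"
    using lborel_has_bochner_integral_real_affine_iff[of c "\<lambda>x. std_normal_density x *\<^sub>R exp (\<i> * of_real (u * x))" _ 0] 1 c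
    by simp
  then have "has_bochner_integral lborel
      (\<lambda>x. of_real (sqrt (2 * pi)) * (std_normal_density (0 + c * x) *\<^sub>R exp (\<i> * of_real (u * (0 + c * x)))))
      (of_real (sqrt (2 * pi)) * (of_real (exp (- u\<^sup>2 / 2)) /\<^sub>R \<bar>c\<bar>))"
    by (intro has_bochner_integral_mult_right) auto
  also have "(\<lambda>x. of_real (sqrt (2 * pi)) * (std_normal_density (0 + c * x) *\<^sub>R exp (\<i> * of_real (u * (0 + c * x)))))
      = (\<lambda>x. of_real (exp (- t * x\<^sup>2)) * e (of_real (a * x)))"
  proof
    fix x
    have "sqrt (2 * pi) * std_normal_density (c * x) = exp (- t * x\<^sup>2)"
      by (simp add: std_normal_density_def power_mult_distrib c)
    moreover have "u * (c * x) = 2 * pi * (a * x)"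
      using c by (simp add: u_def)
    then have "e (of_real (a * x)) = exp (\<i> * of_real (u * (0 + c * x)))"
      by (simp only: e_of_real add_0)
    ultimately show "of_real (sqrt (2 * pi)) * (std_normal_density (0 + c * x) *\<^sub>R exp (\<i> * of_real (u * (0 + c * x))))
        = of_real (exp (- t * x\<^sup>2)) * e (of_real (a * x))"
      by (simp add: scaleR_conv_of_real del: of_real_mult flip: mult.assoc) (simp flip: of_real_mult add: mult_ac)
  qed
  also have "of_real (sqrt (2 * pi)) * (complex_of_real (exp (- u\<^sup>2 / 2)) /\<^sub>R \<bar>c\<bar>)
      = of_real (sqrt (pi / t) * exp (- pi\<^sup>2 * a\<^sup>2 / t))"
  proof -
    have "- u\<^sup>2 / 2 = - pi\<^sup>2 * a\<^sup>2 / t"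
      by (simp add: u_def power_divide power_mult_distrib c)
    moreover have "sqrt (2 * pi) / c = sqrt (pi / t)"
      using t by (simp add: c_def real_sqrt_divide real_sqrt_mult)
    ultimately show ?thesis
      using c by (simp add: scaleR_conv_of_real field_simps flip: of_real_mult of_real_divide)
  qed
  finally show ?thesis .
qed

text \<open>The integrand is a product of functions of the single coordinates, so the integral over
  the product measure is the product of the one-dimensional transforms.\<close>

lemma gaussian_fourier:
  fixes a :: "'a::euclidean_space"
  assumes t: "t > 0"
  shows "has_bochner_integral lborel (\<lambda>x. of_real (exp (- t * (x \<bullet> x))) * e (of_real (a \<bullet> x)))
           (of_real (sqrt (pi / t) ^ DIM('a) * exp (- pi\<^sup>2 * (a \<bullet> a) / t)))"
proof -
  interpret product_sigma_finite "\<lambda>b::'a. lborel :: real measure" ..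
  define g where "g b u = of_real (exp (- t * u\<^sup>2)) * e (of_real ((a \<bullet> b) * u))" for b :: 'a and u :: real
  define F where "F x = of_real (exp (- t * (x \<bullet> x))) * e (of_real (a \<bullet> x))" for x :: 'a
  have g: "has_bochner_integral lborel (g b) (of_real (sqrt (pi / t) * exp (- pi\<^sup>2 * (a \<bullet> b)\<^sup>2 / t)))" for b
    unfolding g_def by (rule gaussian_fourier_real[OF t])
  have F: "F x = (\<Prod>b\<in>Basis. g b (x \<bullet> b))" for x
  proof -
    have "- t * (x \<bullet> x) = (\<Sum>b\<in>Basis. - t * (x \<bullet> b)\<^sup>2)"
      by (simp add: euclidean_inner[of x x] sum_distrib_left power2_eq_square sum_negf)
    moreover have "complex_of_real (a \<bullet> x) = (\<Sum>b\<in>Basis. of_real ((a \<bullet> b) * (x \<bullet> b)))"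
      by (simp add: euclidean_inner[of a x])
    ultimately show ?thesis
      unfolding F_def g_def by (simp add: exp_sum e_sum prod.distrib)
  qed
  have Fm [measurable]: "F \<in> borel_measurable borel"
    unfolding F_def by measurable
  have F': "F (\<Sum>b\<in>Basis. y b *\<^sub>R b) = (\<Prod>b\<in>Basis. g b (y b))" for y
    unfolding F by (intro prod.cong) auto
  have gi: "integrable lborel (g b)" "(LINT u|lborel. g b u) = of_real (sqrt (pi / t) * exp (- pi\<^sup>2 * (a \<bullet> b)\<^sup>2 / t))" for b
    using g[of b] by (auto simp: has_bochner_integral_iff)
  have "integrable (\<Pi>\<^sub>M b\<in>Basis. lborel) (\<lambda>y. \<Prod>b\<in>Basis. g b (y b))"
    by (intro product_integrable_prod gi) auto
  then have "integrable lborel F"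
    by (subst lborel_eq) (simp add: integrable_distr_eq F')
  moreover have "(LINT x|lborel. F x) = (LINT y|(\<Pi>\<^sub>M b\<in>Basis. lborel). (\<Prod>b\<in>Basis. g b (y b)))"
    by (subst lborel_eq) (simp add: integral_distr F')
  moreover have "(LINT y|(\<Pi>\<^sub>M b\<in>Basis. lborel). (\<Prod>b\<in>Basis. g b (y b))) = (\<Prod>b\<in>Basis. (LINT u|lborel. g b u))"
    by (intro product_integral_prod gi) auto
  moreover have "(\<Prod>b\<in>Basis. (LINT u|lborel. g b u)) = of_real (sqrt (pi / t) ^ DIM('a) * exp (- pi\<^sup>2 * (a \<bullet> a) / t))"
  proof -
    have "- pi\<^sup>2 * (a \<bullet> a) / t = (\<Sum>b\<in>Basis. - pi\<^sup>2 * (a \<bullet> b)\<^sup>2 / t)"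
      by (simp add: euclidean_inner[of a a] sum_distrib_left power2_eq_square sum_negf sum_divide_distrib)
    then show ?thesis
      by (simp add: gi exp_sum prod.distrib flip: of_real_prod of_real_mult)
  qed
  ultimately show ?thesis
    unfolding F_def by (simp add: has_bochner_integral_iff)
qed

section \<open>The Gamma and Bessel integrals\<close>

lemma borel_measurable_of_real_powr [measurable]:
  "(\<lambda>t::real. complex_of_real t powr z) \<in> borel_measurable borel"
proof -
  have "(\<lambda>t::real. complex_of_real t powr z) = (\<lambda>t. if t = 0 then 0
      else if t > 0 then exp (z * of_real (ln t)) else exp (z * (of_real (ln (- t)) + \<i> * of_real pi)))"
  proof
    fix t :: real
    show "complex_of_real t powr z = (if t = 0 then 0
      else if t > 0 then exp (z * of_real (ln t)) else exp (z * (of_real (ln (- t)) + \<i> * of_real pi)))"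
      using Ln_minus[of "of_real (- t)"] Ln_of_real[of "- t"] by (auto simp: powr_def Ln_of_real)
  qed
  also have "\<dots> \<in> borel_measurable borel"
    by measurable
  finally show ?thesis .
qed

text \<open>The Gamma integral and the change of variables are available for gauge integrals and
  \<open>lebesgue\<close>; this carries them to \<open>lborel\<close>, where Fubini is
  applied.\<close>

lemma has_bochner_integral_of_has_integral:
  fixes f :: "real \<Rightarrow> complex"
  assumes ai: "f absolutely_integrable_on S" and int: "(f has_integral I) S"
    and [measurable]: "f \<in> borel_measurable borel" "S \<in> sets borel"
  shows "has_bochner_integral lborel (\<lambda>x. indicator S x *\<^sub>R f x) I"
proof -
  have "integrable lborel (\<lambda>x. indicator S x *\<^sub>R f x)"
    using ai by (simp add: set_integrable_def integrable_completion)
  moreover have "(LINT x|lborel. indicator S x *\<^sub>R f x) = (LINT x:S|lebesgue. f x)"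
    by (simp add: set_lebesgue_integral_def integral_completion)
  moreover have "(LINT x:S|lebesgue. f x) = I"
    using set_lebesgue_integral_eq_integral(2)[OF ai] int by (simp add: integral_unique)
  ultimately show ?thesis
    by (simp add: has_bochner_integral_iff)
qed

text \<open>Substituting \<open>p * t\<close> for \<open>t\<close> in Euler's integral produces the
  Jacobian \<open>1 / p\<close>. The prefactor \<open>p powr (1 - s)\<close> cancels the power of
  \<open>p\<close> in the integrand and combines with the Jacobian to
  \<open>p powr (- s)\<close>.\<close>

lemma Gamma_integral_scaled:
  fixes s :: complex
  assumes s: "Re s > 0" and p: "p > 0"
  shows "has_bochner_integral lborel
           (\<lambda>t. indicator {0<..} t *\<^sub>R (of_real t powr (s - 1) * of_real (exp (- p * t))))
           (Gamma s * of_real p powr (- s))"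
proof -
  let ?f = "\<lambda>t. indicator {0<..} t *\<^sub>R (of_real t powr (s - 1) / of_real (exp t)) :: complex"
  have "has_bochner_integral lborel ?f (Gamma s)"
    by (rule has_bochner_integral_of_has_integral)
       (use absolutely_integrable_Gamma_integral'[OF s] Gamma_integral_complex'[OF s] in auto)
  then have "has_bochner_integral lborel (\<lambda>t. ?f (0 + p * t)) (Gamma s /\<^sub>R \<bar>p\<bar>)"
    using lborel_has_bochner_integral_real_affine_iff[of p ?f _ 0] p by simp
  then have "has_bochner_integral lborel (\<lambda>t. of_real p powr (1 - s) * ?f (0 + p * t))
      (of_real p powr (1 - s) * (Gamma s /\<^sub>R \<bar>p\<bar>))"
    by (intro has_bochner_integral_mult_right) auto
  also have "(\<lambda>t. of_real p powr (1 - s) * ?f (0 + p * t))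
      = (\<lambda>t. indicator {0<..} t *\<^sub>R (of_real t powr (s - 1) * of_real (exp (- p * t))))"
  proof
    fix t
    have "of_real (p * t) powr (s - 1) = of_real p powr (s - 1) * of_real t powr (s - 1)" if "t > 0"
      using p that by (simp add: powr_times_real_left)
    moreover have "of_real p powr (1 - s) * of_real p powr (s - 1) = 1"
      using p by (simp flip: powr_add)
    ultimately show "of_real p powr (1 - s) * ?f (0 + p * t)
      = indicator {0<..} t *\<^sub>R (of_real t powr (s - 1) * of_real (exp (- p * t)))"
      using p by (auto simp: indicator_def zero_less_mult_iff exp_minus field_simps)
  qed
  also have "of_real p powr (1 - s) * (Gamma s /\<^sub>R \<bar>p\<bar>) = Gamma s * of_real p powr (- s)"
    using p by (simp add: powr_diff powr_minus scaleR_conv_of_real field_simps)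
  finally show ?thesis .
qed


text \<open>Since \<open>cosh u\<close> is even, averaging the integrand over \<open>u\<close> and
  \<open>- u\<close> replaces the exponential by \<open>cosh (\<nu> * u)\<close>. The resulting even
  function has twice its half-line integral.\<close>

lemma Bessel_K_eq_full_line:
  assumes int: "integrable lborel (\<lambda>u. exp (\<nu> * of_real u) * of_real (exp (- x * cosh u)))"
  shows "(LINT u|lborel. exp (\<nu> * of_real u) * of_real (exp (- x * cosh u))) = 2 * Bessel_K \<nu> x"
proof -
  define F where "F u = exp (\<nu> * complex_of_real u) * of_real (exp (- x * cosh u))" for u
  define G where "G u = of_real (exp (- x * cosh u)) * cosh (\<nu> * complex_of_real u)" for u
  have F: "has_bochner_integral lborel F (LINT u|lborel. F u)"
    using int by (simp add: F_def[abs_def] has_bochner_integral_iff)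
  then have "has_bochner_integral lborel (\<lambda>u. F (- u)) (LINT u|lborel. F u)"
    using lborel_has_bochner_integral_real_affine_iff[of "-1" F _ 0] by simp
  then have "has_bochner_integral lborel (\<lambda>u. (F u + F (- u)) / 2) (((LINT u|lborel. F u) + (LINT u|lborel. F u)) / 2)"
    by (intro has_bochner_integral_divide has_bochner_integral_add F) auto
  also have "(\<lambda>u. (F u + F (- u)) / 2) = G"
    by (simp add: F_def G_def fun_eq_iff cosh_def scaleR_conv_of_real field_simps)
  finally have G: "has_bochner_integral lborel G (LINT u|lborel. F u)"
    by simp
  then have "integrable lborel (\<lambda>u. indicator {0..} u *\<^sub>R G u)"
    by (intro integrable_mult_indicator) (auto simp: has_bochner_integral_iff)
  then have "has_bochner_integral lborel (\<lambda>u. indicator {0..} u *\<^sub>R G u) (Bessel_K \<nu> x)"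
    by (simp add: has_bochner_integral_iff Bessel_K_def set_lebesgue_integral_def G_def)
  then have "has_bochner_integral lborel G (Bessel_K \<nu> x + Bessel_K \<nu> x)"
    using has_bochner_integral_even_function[of G "Bessel_K \<nu> x"] by (simp add: G_def scaleR_conv_of_real)
  with G have "(LINT u|lborel. F u) = 2 * Bessel_K \<nu> x"
    using has_bochner_integral_eq by fastforce
  then show ?thesis
    by (simp add: F_def)
qed

lemma Bessel_K_minus: "Bessel_K (- \<nu>) x = Bessel_K \<nu> x"
  by (simp add: Bessel_K_def)

text \<open>The substitution \<open>t = sqrt (b / p) * exp u\<close> balances the two exponents:
  \<open>p * t\<close> and \<open>b / t\<close> become \<open>sqrt (p * b)\<close> times
  \<open>exp u\<close> and \<open>exp (- u)\<close>, with sum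
  \<open>2 * sqrt (p * b) * cosh u\<close>.\<close>

lemma Bessel_K_integral:
  fixes \<nu> :: complex
  assumes \<nu>: "Re \<nu> > 0" and p: "p > 0" and b: "b > 0"
  shows "(LINT t|lborel. indicator {0<..} t *\<^sub>R (of_real t powr (\<nu> - 1) * of_real (exp (- p * t - b / t))))
           = 2 * of_real (sqrt (b / p)) powr \<nu> * Bessel_K \<nu> (2 * sqrt (p * b))"
proof -
  define f where "f t = complex_of_real t powr (\<nu> - 1) * of_real (exp (- p * t - b / t))" for t
  define r where "r = sqrt (b / p)"
  define g where "g u = r * exp u" for u
  define F where "F u = exp (\<nu> * of_real u) * complex_of_real (exp (- (2 * sqrt (p * b)) * cosh u))" for u
  have [measurable]: "F \<in> borel_measurable borel"
    unfolding F_def by (intro borel_measurable_continuous_onI continuous_intros)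
  have r: "r > 0" "p * r = sqrt (p * b)" "b / r = sqrt (p * b)"
  proof -
    show r: "r > 0" using p b by (simp add: r_def)
    have "r\<^sup>2 = b / p" using p b by (simp add: r_def)
    then have "(p * r)\<^sup>2 = p * b" "b / r = p * r"
      using p r by (simp_all add: power_mult_distrib power2_eq_square field_simps)
    then show "p * r = sqrt (p * b)" "b / r = sqrt (p * b)"
      using p r by (auto intro: real_sqrt_unique[symmetric])
  qed
  have [measurable]: "f \<in> borel_measurable borel"
    unfolding f_def by measurable
  \<comment> \<open>Since \<open>exp (- b / t)\<close> is at most 1, the Gamma integrand is a
    majorant; this is where \<open>Re \<nu> > 0\<close> enters.\<close>
  have "integrable lborel (\<lambda>t. indicator {0<..} t *\<^sub>R f t)"
  proof (rule Bochner_Integration.integrable_bound)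
    show "integrable lborel (\<lambda>t. indicator {0<..} t *\<^sub>R (of_real t powr (\<nu> - 1) * of_real (exp (- p * t)) :: complex))"
      using Gamma_integral_scaled[OF \<nu> p] by (simp add: has_bochner_integral_iff)
    show "AE t in lborel. norm (indicator {0<..} t *\<^sub>R f t)
        \<le> norm (indicator {0<..} t *\<^sub>R (of_real t powr (\<nu> - 1) * of_real (exp (- p * t)) :: complex))"
      using b by (intro AE_I2) (auto simp: f_def norm_mult indicator_def intro!: mult_left_mono)
  qed simp
  then have ai: "f absolutely_integrable_on {0<..}"
    by (simp add: set_integrable_def integrable_completion)
  have img: "range g = {0<..}"
  proof -
    have "y \<in> range g" if "y > 0" for y
      using that r by (intro image_eqI[of _ _ "ln (y / r)"]) (auto simp: g_def)
    then show ?thesis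
      using r by (auto simp: g_def)
  qed
  \<comment> \<open>The map \<open>g\<close> is its own derivative, so the Jacobian is
    \<open>\<bar>g u\<bar>\<close>; it raises the power \<open>\<nu> - 1\<close> to
    \<open>\<nu>\<close>.\<close>
  have "(\<lambda>u. \<bar>g u\<bar> *\<^sub>R f (g u)) absolutely_integrable_on UNIV \<and>
          integral UNIV (\<lambda>u. \<bar>g u\<bar> *\<^sub>R f (g u)) = integral (range g) f"
  proof (subst has_absolute_integral_change_of_variables_real)
    show "(g has_field_derivative g u) (at u within UNIV)" for u
      unfolding g_def by (auto intro!: derivative_eq_intros)
    show "inj g"
      using r by (auto simp: g_def inj_on_def)
  qed (use ai in \<open>simp_all add: img\<close>)
  moreover have "\<bar>g u\<bar> *\<^sub>R f (g u) = of_real r powr \<nu> * F u" for u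
  proof -
    have "of_real (g u) powr \<nu> = of_real r powr \<nu> * exp (\<nu> * of_real u)"
    proof -
      have "of_real (g u) powr \<nu> = of_real r powr \<nu> * of_real (exp u) powr \<nu>"
        using r by (simp add: g_def powr_times_real_left)
      also have "of_real (exp u) powr \<nu> = exp (\<nu> * of_real u)"
        by (simp add: powr_def flip: exp_of_real)
      finally show ?thesis .
    qed
    moreover have "of_real (g u) * complex_of_real (g u) powr (\<nu> - 1) = of_real (g u) powr \<nu>"
      using r by (simp add: powr_diff g_def)
    moreover have "- p * g u - b / g u = - (2 * sqrt (p * b)) * cosh u"
    proof -
      have "- p * g u - b / g u = - (p * r) * exp u - (b / r) * exp (- u)"
        by (simp add: g_def exp_minus field_simps)
      also have "\<dots> = - (2 * sqrt (p * b)) * cosh u"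
        unfolding r by (simp add: cosh_def field_simps)
      finally show ?thesis .
    qed
    moreover have "g u > 0"
      using r by (simp add: g_def)
    ultimately show ?thesis
      by (simp add: f_def F_def scaleR_conv_of_real mult.assoc [symmetric])
  qed
  ultimately have FF: "(\<lambda>u. of_real r powr \<nu> * F u) absolutely_integrable_on UNIV"
    "integral UNIV (\<lambda>u. of_real r powr \<nu> * F u) = integral {0<..} f"
    by (simp_all add: img)
  have "integrable lborel (\<lambda>u. of_real r powr \<nu> * F u)"
    using FF(1) by (simp add: set_integrable_def integrable_completion)
  then have "integrable lborel (\<lambda>u. (of_real r powr \<nu> * F u) / of_real r powr \<nu>)"
    by (rule integrable_divide_zero[rotated])
  then have F: "integrable lborel F"
    using r by (simp add: powr_def)
  have "(LINT t|lborel. indicator {0<..} t *\<^sub>R f t) = integral {0<..} f"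
    using has_bochner_integral_of_has_integral[OF ai integrable_integral] ai
    by (auto simp: has_bochner_integral_iff set_lebesgue_integral_eq_integral(1))
  also have "\<dots> = of_real r powr \<nu> * (LINT u|lborel. F u)"
    using F by (subst FF(2)[symmetric]) (simp add: integral_lborel)
  also have "(LINT u|lborel. F u) = 2 * Bessel_K \<nu> (2 * sqrt (p * b))"
    unfolding F_def by (rule Bessel_K_eq_full_line) (use F in \<open>simp add: F_def[abs_def]\<close>)
  finally show ?thesis
    by (simp add: f_def r_def)
qed


section \<open>Fourier transform of a power of \<open>x \<bullet> x + p\<close>\<close>

lemma sqrt_power_eq_powr:
  assumes "y > 0"
  shows "sqrt y ^ n = y powr (real n / 2)"
proof -
  have "sqrt y ^ n = (y powr (1 / 2)) powr real n"
    using assms by (simp add: powr_half_sqrt powr_realpow)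
  then show ?thesis
    by (simp add: powr_powr)
qed

text \<open>The Gamma integral writes \<open>Gamma s\<close> times the inverse power as an integral
  of Gaussians in \<open>x\<close> against \<open>t powr (s - 1) * exp (- p * t)\<close>. Exchanging
  the integrals brings in \<open>sqrt (pi / t) ^ DIM('a)\<close>, which lowers the exponent of
  \<open>t\<close> by half the dimension.\<close>

lemma
  fixes a :: "'a::euclidean_space" and s :: complex
  assumes s: "Re s > DIM('a) / 2" and p: "p > 0"
  shows integrable_inverse_power_fourier:
      "integrable lborel (\<lambda>x. of_real (x \<bullet> x + p) powr (- s) * e (of_real (a \<bullet> x)))"
    and integral_inverse_power_fourier:
      "Gamma s * (LINT x|lborel. of_real (x \<bullet> x + p) powr (- s) * e (of_real (a \<bullet> x)))
        = of_real (pi powr (DIM('a) / 2)) * (LINT t|lborel. indicator {0<..} t *\<^sub>R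
            (of_real t powr (s - of_real (DIM('a) / 2) - 1) * of_real (exp (- p * t - pi\<^sup>2 * (a \<bullet> a) / t))))"
proof -
  define d where "d = DIM('a) / 2"
  define H where "H t x = indicat_real {0<..} t *\<^sub>R (of_real t powr (s - 1) * of_real (exp (- p * t)) *
      (of_real (exp (- t * (x \<bullet> x))) * e (of_real (a \<bullet> x))))" for t :: real and x :: 'a
  have d: "d \<ge> 0" "Re s > d" "Re s > 0"
    using s by (auto simp: d_def intro: order.strict_trans1[of 0 "DIM('a) / 2"])
  have sq: "sqrt (pi / t) ^ DIM('a) = pi powr d * t powr - d" if "t > 0" for t
    using that by (simp add: sqrt_power_eq_powr d_def powr_divide powr_minus divide_simps)
  have G: "has_bochner_integral lborel (H t) (indicat_real {0<..} t *\<^sub>R (of_real t powr (s - 1) * of_real (exp (- p * t)) *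
      (of_real (sqrt (pi / t) ^ DIM('a) * exp (- pi\<^sup>2 * (a \<bullet> a) / t)))))" for t
  proof (cases "t > 0")
    case True
    show ?thesis
      unfolding H_def
      by (intro has_bochner_integral_scaleR_right has_bochner_integral_mult_right gaussian_fourier True)
  next
    case False
    then show ?thesis by (simp add: H_def[abs_def] has_bochner_integral_zero)
  qed
  \<comment> \<open>The absolute integral over \<open>x\<close> is the modulus of a multiple of the
    Gamma integrand with parameter \<open>s - d\<close>. Its integrability in \<open>t\<close>, and
    with it Fubini, rests on \<open>Re s > d\<close>.\<close>
  have N: "(LINT x|lborel. norm (H t x)) = norm (of_real (pi powr d) *
      (indicat_real {0<..} t *\<^sub>R (of_real t powr ((s - of_real d) - 1) * complex_of_real (exp (- p * t)))))" for t
  proof (cases "t > 0")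
    case True
    have "has_bochner_integral lborel (\<lambda>x::'a. complex_of_real (exp (- t * (x \<bullet> x)))) (of_real (sqrt (pi / t) ^ DIM('a)))"
      using gaussian_fourier[OF True, of "0 :: 'a"] by (simp add: e_def)
    then have "complex_of_real (LINT x::'a|lborel. exp (- t * (x \<bullet> x))) = of_real (sqrt (pi / t) ^ DIM('a))"
      by (subst integral_complex_of_real[symmetric]) (auto simp: has_bochner_integral_iff)
    then have 1: "(LINT x::'a|lborel. exp (- t * (x \<bullet> x))) = sqrt (pi / t) ^ DIM('a)"
      by (simp only: of_real_eq_iff)
    have "(LINT x|lborel. norm (H t x))
        = (LINT x::'a|lborel. (t powr (Re s - 1) * exp (- p * t)) * exp (- t * (x \<bullet> x)))"
      using True by (intro Bochner_Integration.integral_cong) (auto simp: H_def norm_mult norm_powr_real_powr)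
    also have "\<dots> = t powr (Re s - 1) * exp (- p * t) * (pi powr d * t powr - d)"
      by (subst integral_mult_right_zero) (simp only: 1 sq[OF True])
    finally have "(LINT x|lborel. norm (H t x)) = pi powr d * (t powr (Re s - d - 1) * exp (- p * t))"
      using True by (simp add: powr_diff powr_minus powr_add field_simps)
    moreover have "norm (complex_of_real t powr (s - of_real d - 1)) = t powr (Re s - d - 1)"
      using True by (simp add: norm_powr_real_powr)
    ultimately show ?thesis
      using True by (simp add: norm_mult)
  qed (simp add: H_def)
  have Hm [measurable]: "(\<lambda>(t, x). H t x) \<in> borel_measurable (lborel \<Otimes>\<^sub>M lborel)"
    unfolding H_def by measurable
  have int: "integrable (lborel \<Otimes>\<^sub>M lborel) (\<lambda>(t, x). H t x)"
  proof (rule lborel_pair.Fubini_integrable)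
    have "integrable lborel (\<lambda>t. indicat_real {0<..} t *\<^sub>R
        (of_real t powr ((s - of_real d) - 1) * complex_of_real (exp (- p * t))))"
      using Gamma_integral_scaled[of "s - of_real d" p] d p by (simp add: has_bochner_integral_iff)
    then have "integrable lborel (\<lambda>t. of_real (pi powr d) * (indicat_real {0<..} t *\<^sub>R
        (of_real t powr ((s - of_real d) - 1) * complex_of_real (exp (- p * t)))))"
      by (rule integrable_mult_right)
    then show "integrable lborel (\<lambda>t. LINT x|lborel. norm (case (t, x) of (t, x) \<Rightarrow> H t x))"
      unfolding prod.case N by (rule integrable_norm)
  qed (use G in \<open>auto simp: has_bochner_integral_iff\<close>)
  have T: "(LINT t|lborel. H t x) = Gamma s * (of_real (x \<bullet> x + p) powr (- s) * e (of_real (a \<bullet> x)))" for x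
  proof -
    have "x \<bullet> x + p > 0"
      using p by (simp add: add_nonneg_pos)
    from Gamma_integral_scaled[OF d(3) this]
    have "has_bochner_integral lborel (\<lambda>t. indicat_real {0<..} t *\<^sub>R (of_real t powr (s - 1) *
        of_real (exp (- (x \<bullet> x + p) * t))) * e (of_real (a \<bullet> x)))
        (Gamma s * of_real (x \<bullet> x + p) powr (- s) * e (of_real (a \<bullet> x)))"
      by (intro has_bochner_integral_mult_left)
    also have "(\<lambda>t. indicat_real {0<..} t *\<^sub>R (of_real t powr (s - 1) *
        of_real (exp (- (x \<bullet> x + p) * t))) * e (of_real (a \<bullet> x))) = (\<lambda>t. H t x)"
    proof
      fix t
      have "exp (- (x \<bullet> x + p) * t) = exp (- p * t) * exp (- t * (x \<bullet> x))"
        by (simp add: algebra_simps flip: exp_add)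
      then show "indicat_real {0<..} t *\<^sub>R (of_real t powr (s - 1) *
        of_real (exp (- (x \<bullet> x + p) * t))) * e (of_real (a \<bullet> x)) = H t x"
        by (simp add: H_def mult_ac)
    qed
    finally show ?thesis
      by (simp add: has_bochner_integral_iff mult.assoc)
  qed
  \<comment> \<open>Fubini yields integrability only with the factor \<open>Gamma s\<close>, which
    has to be divided out.\<close>
  have Gs: "Gamma s \<noteq> 0"
    using d(3) by (auto simp: Gamma_eq_zero_iff elim!: nonpos_Ints_cases)
  have "integrable lborel (\<lambda>x. Gamma s * (of_real (x \<bullet> x + p) powr (- s) * e (of_real (a \<bullet> x))))"
    using lborel_pair.integrable_snd[OF int] by (simp add: T)
  then have "integrable lborel (\<lambda>x. (1 / Gamma s) * (Gamma s * (of_real (x \<bullet> x + p) powr (- s) * e (of_real (a \<bullet> x)))))"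
    by (rule integrable_mult_right)
  then show "integrable lborel (\<lambda>x. of_real (x \<bullet> x + p) powr (- s) * e (of_real (a \<bullet> x)))"
    using Gs by (simp del: of_real_add)
  have "Gamma s * (LINT x|lborel. of_real (x \<bullet> x + p) powr (- s) * e (of_real (a \<bullet> x)))
      = (LINT x|lborel. (LINT t|lborel. H t x))"
    by (simp add: T)
  also have "\<dots> = (LINT t|lborel. (LINT x|lborel. H t x))"
    by (rule lborel_pair.Fubini_integral[OF int])
  also have "\<dots> = (LINT t|lborel. of_real (pi powr d) * (indicator {0<..} t *\<^sub>R
            (of_real t powr (s - of_real d - 1) * of_real (exp (- p * t - pi\<^sup>2 * (a \<bullet> a) / t)))))"
  proof (intro Bochner_Integration.integral_cong refl)
    fix t
    have "(LINT x|lborel. H t x) = indicat_real {0<..} t *\<^sub>R (of_real t powr (s - 1) * of_real (exp (- p * t)) *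
      (of_real (sqrt (pi / t) ^ DIM('a) * exp (- pi\<^sup>2 * (a \<bullet> a) / t))))"
      using G[of t] by (simp add: has_bochner_integral_iff)
    also have "\<dots> = of_real (pi powr d) * (indicator {0<..} t *\<^sub>R
            (of_real t powr (s - of_real d - 1) * of_real (exp (- p * t - pi\<^sup>2 * (a \<bullet> a) / t))))"
    proof (cases "t > 0")
      case True
      have "exp (- p * t - pi\<^sup>2 * (a \<bullet> a) / t) = exp (- p * t) * exp (- pi\<^sup>2 * (a \<bullet> a) / t)"
        by (simp flip: exp_add)
      moreover have "complex_of_real (t powr - d) * of_real t powr (s - 1) = of_real t powr (s - of_real d - 1)"
      proof -
        have "complex_of_real (t powr - d) = of_real t powr of_real (- d)"
          using True by (subst powr_of_real) auto
        moreover have "of_real (- d) + (s - 1) = s - of_real d - 1"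
          by simp
        ultimately show ?thesis
          by (metis powr_add)
      qed
      ultimately show ?thesis
        using True by (simp only: sq[OF True]) (simp add: mult_ac)
    qed simp
    finally show "(LINT x|lborel. H t x) = of_real (pi powr d) * (indicator {0<..} t *\<^sub>R
            (of_real t powr (s - of_real d - 1) * of_real (exp (- p * t - pi\<^sup>2 * (a \<bullet> a) / t))))" .
  qed
  finally show "Gamma s * (LINT x|lborel. of_real (x \<bullet> x + p) powr (- s) * e (of_real (a \<bullet> x)))
        = of_real (pi powr (DIM('a) / 2)) * (LINT t|lborel. indicator {0<..} t *\<^sub>R
            (of_real t powr (s - of_real (DIM('a) / 2) - 1) * of_real (exp (- p * t - pi\<^sup>2 * (a \<bullet> a) / t))))"
    by (simp only: integral_mult_right_zero d_def)
qed

section \<open>Roots and cosets\<close>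

lemma rcong_iff: "[a = b] (rmod m) \<longleftrightarrow> (\<exists>n::int. a = b + of_int n * m)"
  by (subst rcong_sym_iff) (rule rcong_altdef)

context
  fixes L :: "(real ^ 24) set"
  assumes L: "full_lattice L"
begin

lemma equiv_cong_mod_multiple: "equiv L (cong_mod_multiple L m)"
proof (rule equivI)
  show "cong_mod_multiple L m \<subseteq> L \<times> L"
    by (auto simp: cong_mod_multiple_def)
  show "refl_on L (cong_mod_multiple L m)"
    by (auto simp: refl_on_def cong_mod_multiple_def intro!: bexI[of _ 0] full_lattice_0[OF L])
  show "sym (cong_mod_multiple L m)"
  proof (rule symI)
    fix x y assume "(x, y) \<in> cong_mod_multiple L m"
    then obtain w where "x \<in> L" "y \<in> L" "w \<in> L" "x - y = real m *\<^sub>R w"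
      by (auto simp: cong_mod_multiple_def)
    then show "(y, x) \<in> cong_mod_multiple L m"
      by (auto simp: cong_mod_multiple_def algebra_simps intro!: bexI[of _ "- w"] full_lattice_uminus[OF L])
  qed
  show "trans (cong_mod_multiple L m)"
  proof (rule transI)
    fix x y z assume "(x, y) \<in> cong_mod_multiple L m" "(y, z) \<in> cong_mod_multiple L m"
    then obtain v w where "x \<in> L" "z \<in> L" "v \<in> L" "w \<in> L" "x - y = real m *\<^sub>R v" "y - z = real m *\<^sub>R w"
      by (auto simp: cong_mod_multiple_def)
    then show "(x, z) \<in> cong_mod_multiple L m"
      by (auto simp: cong_mod_multiple_def algebra_simps intro!: bexI[of _ "v + w"] full_lattice_add[OF L])
  qed
qed

text \<open>Reducing the coordinates with respect to a basis modulo \<open>m\<close> shows that the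
  vectors with coordinates in \<open>{..<m}\<close> meet every coset. The bound controls the number
  of roots per \<open>m\<close> up to lattice translation.\<close>

lemma quotient_cong_mod_multiple:
  assumes m: "m \<ge> 1"
  shows "finite (L // cong_mod_multiple L m)" "card (L // cong_mod_multiple L m) \<le> m ^ 24"
proof -
  obtain B :: "real ^ 24 ^ 24" where B: "L = {B *v x | x. \<forall>i. x $ i \<in> \<int>}"
    using L by (auto simp: full_lattice_def)
  define v where "v f = B *v (\<chi> i. real (f i))" for f :: "24 \<Rightarrow> nat"
  define F where "F = (UNIV :: 24 set) \<rightarrow>\<^sub>E {..<m}"
  have sub: "L // cong_mod_multiple L m \<subseteq> (\<lambda>f. cong_mod_multiple L m `` {v f}) ` F"
  proof
    fix C assume "C \<in> L // cong_mod_multiple L m"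
    then obtain x where x: "C = cong_mod_multiple L m `` {x}" "x \<in> L"
      by (rule quotientE)
    then obtain z where z: "x = B *v z" "\<forall>i. z $ i \<in> \<int>"
      by (auto simp: B)
    \<comment> \<open>Division with remainder in each coordinate: the quotients give the multiple of
      \<open>m\<close> to be removed, the remainders the representative.\<close>
    define q r where "q i = \<lfloor>z $ i\<rfloor> div int m" and "r i = nat (\<lfloor>z $ i\<rfloor> mod int m)" for i
    have zi: "z $ i = real m * of_int (q i) + real (r i)" for i
    proof -
      have "\<lfloor>z $ i\<rfloor> = int m * q i + int (r i)"
        using m by (simp add: q_def r_def)
      moreover have "z $ i = of_int \<lfloor>z $ i\<rfloor>"
        using z(2) by (simp add: of_int_floor_cancel)
      ultimately show ?thesis
        by (metis of_int_add of_int_mult of_int_of_nat_eq)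
    qed
    define w where "w = B *v (\<chi> i. of_int (q i))"
    have "z = real m *\<^sub>R (\<chi> i. of_int (q i)) + (\<chi> i. real (r i))"
      by (simp add: vec_eq_iff zi)
    then have "x - v r = real m *\<^sub>R w"
      by (simp add: z v_def w_def matrix_vector_right_distrib matrix_vector_mult_scaleR)
    moreover have "v r \<in> L" "w \<in> L"
      by (auto simp: B v_def w_def intro!: exI)
    ultimately have "(x, v r) \<in> cong_mod_multiple L m"
      using x by (auto simp: cong_mod_multiple_def)
    then have "C = cong_mod_multiple L m `` {v r}"
      using equiv_class_eq[OF equiv_cong_mod_multiple] x by blast
    moreover have "r \<in> F"
      using m by (auto simp: F_def r_def PiE_def nat_less_iff)
    ultimately show "C \<in> (\<lambda>f. cong_mod_multiple L m `` {v f}) ` F"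
      by blast
  qed
  have F: "finite F" "card F = m ^ 24"
    unfolding F_def by (auto intro!: finite_PiE simp: card_funcsetE)
  show "finite (L // cong_mod_multiple L m)"
    using sub F(1) finite_surj by blast
  show "card (L // cong_mod_multiple L m) \<le> m ^ 24"
    using surj_card_le[OF F(1) sub] F(2) by simp
qed

end

text \<open>The index set of \<open>j_sum\<close>. For \<mu> in such a coset the congruence says
  that some integer \<open>n\<close> satisfies \<open>\<mu> \<bullet> \<mu> - 2 * m * n = 2\<close>,
  so that \<mu> extends to a root with second coordinate \<open>m\<close>.\<close>

definition root_cosets :: "(real ^ 24) set \<Rightarrow> nat \<Rightarrow> (real ^ 24) set set" where
  "root_cosets L m = {C \<in> L // cong_mod_multiple L m. \<forall>l\<in>C. [l \<bullet> l / 2 = 1] (rmod real m)}"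

definition rep :: "'a set \<Rightarrow> 'a" where
  "rep C = (SOME x. x \<in> C)"

text \<open>With this sign of \<open>rep C\<close>, the phase arising from the coset \<open>C\<close> is its summand in \<^const>\<open>j_sum\<close>.\<close>

definition pos_root :: "(nat \<times> (real ^ 24) set) \<times> (real ^ 24) \<Rightarrow> lorentz_space" where
  "pos_root = (\<lambda>((m, C), w). let \<mu> = real m *\<^sub>R w - rep C in (\<mu>, real m, (\<mu> \<bullet> \<mu> - 2) / (2 * real m)))"

context
  fixes L :: "(real ^ 24) set"
  assumes leech: "leech_lattice L"
begin

section \<open>Cosets and roots for the Leech lattice\<close>

lemma leech_full: "full_lattice L"
  using leech by (simp add: leech_lattice_def)

lemma leech_inner_Ints: "x \<in> L \<Longrightarrow> y \<in> L \<Longrightarrow> x \<bullet> y \<in> \<int>"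
  using leech by (auto simp: leech_lattice_def dual_lattice_def)

lemma leech_even: "x \<in> L \<Longrightarrow> x \<bullet> x / 2 \<in> \<int>"
  using leech by (auto simp: leech_lattice_def)

text \<open>For \<open>x = y + m w\<close> the half norms differ by \<open>m\<close> times
  \<open>y \<bullet> w + m * (w \<bullet> w / 2)\<close>, an integer because the lattice is integral
  and even.\<close>

lemma rcong_half_norm:
  assumes "(x, y) \<in> cong_mod_multiple L m"
  shows "[x \<bullet> x / 2 = y \<bullet> y / 2] (rmod real m)"
proof -
  obtain w where w: "x \<in> L" "y \<in> L" "w \<in> L" "x = y + real m *\<^sub>R w"
    using assms by (auto simp: cong_mod_multiple_def algebra_simps)
  have "y \<bullet> w + real m * (w \<bullet> w / 2) \<in> \<int>"
    using w by (intro Ints_add Ints_mult leech_inner_Ints leech_even) auto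
  then obtain n where n: "y \<bullet> w + real m * (w \<bullet> w / 2) = of_int n"
    by (auto elim: Ints_cases)
  have "x \<bullet> x / 2 = y \<bullet> y / 2 + (y \<bullet> w + real m * (w \<bullet> w / 2)) * real m"
    unfolding w(4) by (simp add: inner_add_left inner_add_right inner_commute algebra_simps power2_eq_square)
  then show ?thesis
    unfolding rcong_iff n by blast
qed

lemma rep_in:
  assumes "C \<in> L // cong_mod_multiple L m"
  shows "rep C \<in> C" "rep C \<in> L"
proof -
  have "C \<noteq> {}"
    by (rule in_quotient_imp_non_empty[OF equiv_cong_mod_multiple[OF leech_full] assms])
  then show "rep C \<in> C"
    unfolding rep_def by (simp add: some_in_eq)
  then show "rep C \<in> L"
    using in_quotient_imp_subset[OF equiv_cong_mod_multiple[OF leech_full] assms] by blast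
qed

text \<open>Moving by \<open>m w\<close> within a coset multiplies the phase by \<open>e\<close> of
  the integer \<open>w \<bullet> l\<close>, that is by 1. The summand can therefore be read off at
  the representative.\<close>

lemma j_sum_eq_sum_rep:
  assumes m: "m \<ge> 1" and l: "l \<in> L"
  shows "j_sum L l m = (\<Sum>C\<in>root_cosets L m. e (of_real (l \<bullet> rep C / real m)))"
  unfolding j_sum_def root_cosets_def
proof (intro sum.cong refl)
  fix C assume "C \<in> {C \<in> L // cong_mod_multiple L m. \<forall>l\<in>C. [l \<bullet> l / 2 = 1] (rmod real m)}"
  then have C: "C \<in> L // cong_mod_multiple L m"
    by simp
  have "e (complex_of_real (x \<bullet> l) / of_nat m) = e (of_real (l \<bullet> rep C / real m))" if "x \<in> C" for x
  proof -
    have "(x, rep C) \<in> cong_mod_multiple L m"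
      by (rule in_quotient_imp_in_rel[OF equiv_cong_mod_multiple[OF leech_full] C])
         (use that rep_in[OF C] in auto)
    then obtain w where w: "w \<in> L" "x = rep C + real m *\<^sub>R w"
      by (auto simp: cong_mod_multiple_def algebra_simps)
    obtain n where n: "w \<bullet> l = of_int n"
      using leech_inner_Ints[OF w(1) l] by (auto elim: Ints_cases)
    have "x \<bullet> l / real m = l \<bullet> rep C / real m + of_int n"
      using m by (simp add: w(2) inner_add_left n inner_commute[of l] add_divide_distrib)
    then have "complex_of_real (x \<bullet> l) / of_nat m = of_real (l \<bullet> rep C / real m) + of_int n"
      by (metis of_real_add of_real_divide of_real_of_int_eq of_real_of_nat_eq)
    also have "e \<dots> = e (of_real (l \<bullet> rep C / real m)) * e (of_int n)"
      by (rule e_add)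
    finally show ?thesis by simp
  qed
  then have "(\<lambda>x. e (complex_of_real (x \<bullet> l) / of_nat m)) ` C = {e (of_real (l \<bullet> rep C / real m))}"
    using rep_in(1)[OF C] by (auto simp: image_iff)
  then show "the_elem ((\<lambda>x. e (complex_of_real (x \<bullet> l) / of_nat m)) ` C) = e (of_real (l \<bullet> rep C / real m))"
    by simp
qed

text \<open>A root with second coordinate \<open>m > 0\<close> has its third coordinate fixed by the
  first, \<mu>. The coset of \<open>- \<mu>\<close> and the quotient by \<open>m\<close> of the
  difference to its representative recover the parameters \<open>C\<close> and
  \<open>w\<close>.\<close>

lemma bij_betw_pos_root:
  "bij_betw pos_root (Sigma {1..} (root_cosets L) \<times> L) {r \<in> roots L. fst (snd r) > 0}"
proof (rule bij_betw_imageI)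
  note eqv = equiv_cong_mod_multiple[OF leech_full]
  show "inj_on pos_root (Sigma {1..} (root_cosets L) \<times> L)"
  proof (rule inj_onI)
    fix x y
    assume x: "x \<in> Sigma {1..} (root_cosets L) \<times> L" and y: "y \<in> Sigma {1..} (root_cosets L) \<times> L"
      and xy: "pos_root x = pos_root y"
    obtain m C w m' C' w' where xy_eq: "x = ((m, C), w)" "y = ((m', C'), w')"
      by (metis surj_pair)
    have m: "1 \<le> m" "1 \<le> m'" and C: "C \<in> root_cosets L m" "C' \<in> root_cosets L m'"
      and w: "w \<in> L" "w' \<in> L" and eq: "pos_root ((m, C), w) = pos_root ((m', C'), w')"
      using x y xy by (auto simp: xy_eq)
    have mm: "m' = m" and \<mu>: "real m *\<^sub>R w - rep C = real m *\<^sub>R w' - rep C'"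
      using eq by (auto simp: pos_root_def Let_def)
    have C': "C \<in> L // cong_mod_multiple L m" "C' \<in> L // cong_mod_multiple L m"
      using C by (auto simp: root_cosets_def mm)
    have "rep C - rep C' = real m *\<^sub>R (w - w')"
      using \<mu> by (simp add: algebra_simps)
    then have "(rep C, rep C') \<in> cong_mod_multiple L m"
      using rep_in(2)[OF C'(1)] rep_in(2)[OF C'(2)] full_lattice_diff[OF leech_full w]
      by (auto simp: cong_mod_multiple_def)
    then have CC: "C = C'"
      using quotient_eqI[OF eqv C' rep_in(1)[OF C'(1)] rep_in(1)[OF C'(2)]] by simp
    then have "real m *\<^sub>R (w - w') = 0"
      using \<mu> by (simp add: algebra_simps)
    with m CC mm show "x = y"
      by (simp add: xy_eq)
  qed
  show "pos_root ` (Sigma {1..} (root_cosets L) \<times> L) = {r \<in> roots L. fst (snd r) > 0}"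
  proof (intro set_eqI iffI)
    fix r assume "r \<in> pos_root ` (Sigma {1..} (root_cosets L) \<times> L)"
    then obtain m C w where m: "m \<ge> 1" and C: "C \<in> root_cosets L m" and w: "w \<in> L"
      and r: "r = pos_root ((m, C), w)"
      by auto
    have C': "C \<in> L // cong_mod_multiple L m" and one: "[rep C \<bullet> rep C / 2 = 1] (rmod real m)"
      using C rep_in(1) by (auto simp: root_cosets_def)
    define \<mu> where "\<mu> = real m *\<^sub>R w - rep C"
    have \<mu>L: "\<mu> \<in> L"
      unfolding \<mu>_def using rep_in(2)[OF C'] w
      by (intro full_lattice_diff full_lattice_scaleR_nat leech_full)
    \<comment> \<open>The vectors \<open>rep C\<close> and \<open>- \<mu>\<close> are congruent
      modulo \<open>m\<close>, and the half norm does not see the sign.\<close>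
    have "rep C - (- \<mu>) = real m *\<^sub>R w"
      by (simp add: \<mu>_def)
    then have "(rep C, - \<mu>) \<in> cong_mod_multiple L m"
      using rep_in(2)[OF C'] full_lattice_uminus[OF leech_full \<mu>L] w by (auto simp: cong_mod_multiple_def)
    from rcong_trans[OF rcong_sym[OF rcong_half_norm[OF this]] one]
    have "[\<mu> \<bullet> \<mu> / 2 = 1] (rmod real m)"
      by simp
    then obtain n :: int where n: "\<mu> \<bullet> \<mu> / 2 = 1 + of_int n * real m"
      unfolding rcong_iff by blast
    \<comment> \<open>The congruence of the half norm makes the third coordinate an integer.\<close>
    have nn: "(\<mu> \<bullet> \<mu> - 2) / (2 * real m) = of_int n"
      using n m by (simp add: field_simps)
    have "r = (\<mu>, real m, (\<mu> \<bullet> \<mu> - 2) / (2 * real m))"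
      by (simp add: r pos_root_def \<mu>_def Let_def)
    also have "\<dots> = (\<mu>, real m, of_int n)"
      by (simp only: nn)
    finally have "r = (\<mu>, real m, of_int n)" .
    then show "r \<in> {r \<in> roots L. fst (snd r) > 0}"
      using \<mu>L m n by (auto simp: roots_def lorentz_lattice_def)
  next
    fix r assume r: "r \<in> {r \<in> roots L. fst (snd r) > 0}"
    obtain \<mu> a b where rr: "r = (\<mu>, a, b)"
      by (cases r) auto
    have \<mu>: "\<mu> \<in> L" and ab: "a \<in> \<int>" "b \<in> \<int>" "a > 0" and nrm: "\<mu> \<bullet> \<mu> - 2 * a * b = 2"
      using r by (auto simp: rr roots_def lorentz_lattice_def algebra_simps)
    obtain k :: int where k: "a = of_int k"
      using ab by (auto elim: Ints_cases)
    obtain n :: int where n: "b = of_int n"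
      using ab by (auto elim: Ints_cases)
    define m where "m = nat k"
    have m: "a = real m" "m \<ge> 1"
      using ab k by (auto simp: m_def)
    \<comment> \<open>The coset is that of \<open>- \<mu>\<close>, because \<open>pos_root\<close>
      subtracts the representative. For the same reason the lattice parameter below is
      \<open>- w\<close>.\<close>
    define C where "C = cong_mod_multiple L m `` {- \<mu>}"
    have m\<mu>: "- \<mu> \<in> L"
      by (rule full_lattice_uminus[OF leech_full \<mu>])
    then have C: "C \<in> L // cong_mod_multiple L m"
      unfolding C_def by (rule quotientI)
    have "(- \<mu>) \<bullet> (- \<mu>) / 2 = 1 + of_int n * real m"
      using nrm by (simp add: m n algebra_simps)
    then have one: "[(- \<mu>) \<bullet> (- \<mu>) / 2 = 1] (rmod real m)"
      unfolding rcong_iff by blast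
    have "[x \<bullet> x / 2 = 1] (rmod real m)" if "x \<in> C" for x
      using that by (intro rcong_trans[OF rcong_sym[OF rcong_half_norm] one]) (simp add: C_def)
    then have CR: "C \<in> root_cosets L m"
      using C by (simp add: root_cosets_def)
    have "(- \<mu>, rep C) \<in> cong_mod_multiple L m"
      using rep_in(1)[OF C] by (simp add: C_def)
    then obtain w where w: "w \<in> L" "- \<mu> - rep C = real m *\<^sub>R w"
      by (auto simp: cong_mod_multiple_def)
    have "\<mu> = real m *\<^sub>R (- w) - rep C"
      by (simp flip: w(2))
    moreover have "b = (\<mu> \<bullet> \<mu> - 2) / (2 * real m)"
      using nrm m by (simp add: field_simps)
    ultimately have "r = pos_root ((m, C), - w)"
      by (simp add: pos_root_def rr m Let_def)
    then show "r \<in> pos_root ` (Sigma {1..} (root_cosets L) \<times> L)"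
      using m CR full_lattice_uminus[OF leech_full w(1)] by auto
  qed
qed

text \<open>A root with second coordinate 0 would have a first coordinate of norm 2, which the Leech
  lattice excludes; so \<open>r\<close> or \<open>- r\<close> has a positive second
  coordinate.\<close>

lemma roots_split:
  "roots L = {r \<in> roots L. fst (snd r) > 0} \<union> uminus ` {r \<in> roots L. fst (snd r) > 0}"
proof -
  have minus: "- r \<in> roots L" if "r \<in> roots L" for r
    using that full_lattice_uminus[OF leech_full]
    by (cases r) (auto simp: roots_def lorentz_lattice_def)
  have "r \<in> uminus ` {r \<in> roots L. fst (snd r) > 0}" if "r \<in> roots L" "\<not> fst (snd r) > 0" for r
  proof -
    have "fst (snd r) \<noteq> 0"
      using that(1) leech by (cases r) (auto simp: roots_def lorentz_lattice_def leech_lattice_def)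
    then show ?thesis
      using that minus[of r] by (intro image_eqI[of _ _ "- r"]) auto
  qed
  with minus show ?thesis
    by blast
qed

end

section \<open>The series over the roots\<close>

text \<open>Without summability over \<open>P\<close> there is none over \<open>R\<close> either, and both sums are 0.\<close>

lemma infsum_branch_split:
  fixes f :: "'a::ab_group_add \<Rightarrow> complex"
  assumes R: "R = P \<union> uminus ` P" "P \<inter> uminus ` P = {}"
    and f: "\<And>r. r \<in> P \<Longrightarrow> f r = c * f (- r)" and c: "c \<noteq> 0"
  shows "infsum f R = (1 + c) * infsum (\<lambda>r. f (- r)) P"
proof -
  have inj: "inj_on uminus P"
    by simp
  have s1: "f summable_on uminus ` P \<longleftrightarrow> (\<lambda>r. f (- r)) summable_on P"
    and i1: "infsum f (uminus ` P) = infsum (\<lambda>r. f (- r)) P"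
    using summable_on_reindex[OF inj, of f] infsum_reindex[OF inj, of f] by (simp_all add: o_def)
  have "f summable_on P \<longleftrightarrow> (\<lambda>r. c * f (- r)) summable_on P"
    using f by (rule summable_on_cong)
  then have s2: "f summable_on P \<longleftrightarrow> (\<lambda>r. f (- r)) summable_on P"
    using c by (simp add: summable_on_cmult_right')
  have "infsum f P = infsum (\<lambda>r. c * f (- r)) P"
    using f by (rule infsum_cong)
  then have i2: "infsum f P = c * infsum (\<lambda>r. f (- r)) P"
    by (simp add: infsum_cmult_right')
  show ?thesis
  proof (cases "(\<lambda>r. f (- r)) summable_on P")
    case True
    then have "infsum f R = infsum f P + infsum f (uminus ` P)"
      using R s1 s2 by (simp add: infsum_Un_disjoint)
    then show ?thesis
      by (simp add: i1 i2 algebra_simps)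
  next
    case False
    then have "\<not> f summable_on R"
      using s2 R(1) summable_on_subset_banach[of f R P] by blast
    with False show ?thesis
      by (simp add: infsum_not_exists)
  qed
qed

lemma lorentz_form_uminus_left: "lorentz_form (- r) z = - lorentz_form r z"
  by (cases r; cases z) (simp add: algebra_simps)

text \<open>The hypothesis says \<open>k / h\<^sup>2 > 2\<close>, which dominates every
  \<open>2 / n\<^sup>2\<close> with \<open>n \<ge> 1\<close>. The last part gives a lower bound
  uniform in \<open>m\<close>, used to majorise all terms by the one for
  \<open>m = 1\<close>.\<close>

lemma c_coeff_square:
  assumes h: "h > 0" and k: "k > 0" "2 * h\<^sup>2 / k < 1" and m: "m \<ge> 1"
  shows "(c_coeff k h m)\<^sup>2 = k / h\<^sup>2 - 2 / (real m)\<^sup>2" "c_coeff k h m > 0"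
    "(c_coeff k h m)\<^sup>2 \<ge> (c_coeff k h 1)\<^sup>2"
proof -
  have "k / h\<^sup>2 > 2"
    using assms by (simp add: field_simps)
  moreover have "2 / (real n)\<^sup>2 \<le> 2" if "n \<ge> 1" for n
    using that by (simp add: field_simps)
  ultimately have pos: "k / h\<^sup>2 - 2 / (real n)\<^sup>2 > 0" if "n \<ge> 1" for n
    using that by (smt (verit))
  then have sq: "(c_coeff k h n)\<^sup>2 = k / h\<^sup>2 - 2 / (real n)\<^sup>2" if "n \<ge> 1" for n
    using that by (simp add: c_coeff_def less_imp_le)
  show "(c_coeff k h m)\<^sup>2 = k / h\<^sup>2 - 2 / (real m)\<^sup>2"
    by (rule sq[OF m])
  show "c_coeff k h m > 0"
    using pos[OF m] by (simp add: c_coeff_def)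
  show "(c_coeff k h m)\<^sup>2 \<ge> (c_coeff k h 1)\<^sup>2"
    using m by (simp add: sq field_simps)
qed

lemma lorentz_form_pos_root:
  fixes v w :: "real ^ 24" and C :: "(real ^ 24) set"
  assumes h: "h > 0" and k: "k > 0" "2 * h\<^sup>2 / k < 1" and m: "m \<ge> 1"
  defines "x \<equiv> v - w + (1 / real m) *\<^sub>R rep C"
  shows "lorentz_form (pos_root ((m, C), w)) (\<phi> k h v)
           = - (h * real m / 2 * (x \<bullet> x + (c_coeff k h m)\<^sup>2))"
proof -
  define \<mu> where "\<mu> = real m *\<^sub>R w - rep C"
  have x: "x = v - (1 / real m) *\<^sub>R \<mu>"
    using m by (simp add: x_def \<mu>_def algebra_simps)
  have xx: "x \<bullet> x = v \<bullet> v - 2 * (\<mu> \<bullet> v) / real m + \<mu> \<bullet> \<mu> / (real m)\<^sup>2"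
    unfolding x by (simp add: inner_diff_left inner_diff_right inner_commute[of v \<mu>] power2_eq_square diff_divide_distrib)
  have "lorentz_form (pos_root ((m, C), w)) (\<phi> k h v)
      = h * (\<mu> \<bullet> v) - real m * ((h\<^sup>2 * (v \<bullet> v) + k) / (2 * h)) - h * ((\<mu> \<bullet> \<mu> - 2) / (2 * real m))"
    by (simp add: pos_root_def \<phi>_def Let_def flip: \<mu>_def)
  also have "\<dots> = - (h * real m / 2 * (x \<bullet> x + (c_coeff k h m)\<^sup>2))"
    unfolding c_coeff_square(1)[OF h k m] xx using h m by (simp add: field_simps power2_eq_square)
  finally show ?thesis .
qed

text \<open>Roots with positive second coordinate pair negatively with \<open>\<phi> k h v\<close>,
  so they carry the branch factor, while their negatives have a positive real base whose power
  splits into factors. The identity holds for every \<open>s\<close>, as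
  \<open>infsum_branch_split\<close> does not presuppose summability.\<close>

lemma E_series_eq:
  assumes leech: "leech_lattice L"
    and h: "h > 0" and k: "k > 0" "2 * h\<^sup>2 / k < 1"
  shows "E_series L (\<phi> k h v) s = (1 + e (- s / 2)) *
    (\<Sum>\<^sub>\<infinity>((m, C), w)\<in>Sigma {1..} (root_cosets L) \<times> L.
       of_real (h * real m / 2) powr (- s) *
       of_real ((v - w + (1 / real m) *\<^sub>R rep C) \<bullet> (v - w + (1 / real m) *\<^sub>R rep C) + (c_coeff k h m)\<^sup>2) powr (- s))"
proof -
  define P where "P = {r \<in> roots L. fst (snd r) > 0}"
  define I where "I = Sigma {1..} (root_cosets L) \<times> L"
  define f where "f r = complex_of_real (lorentz_form r (\<phi> k h v)) powr (- s)" for r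
  have bij: "bij_betw pos_root I P"
    unfolding I_def P_def by (rule bij_betw_pos_root[OF leech])
  define y where "y = (\<lambda>((m, C), w). h * real m / 2 *
      ((v - w + (1 / real m) *\<^sub>R rep C) \<bullet> (v - w + (1 / real m) *\<^sub>R rep C) + (c_coeff k h m)\<^sup>2))"
  have y: "lorentz_form (pos_root i) (\<phi> k h v) = - y i" "y i > 0" if i: "i \<in> I" for i
  proof -
    obtain m C w where i': "i = ((m, C), w)" "m \<ge> 1"
      using i by (auto simp: I_def)
    show "lorentz_form (pos_root i) (\<phi> k h v) = - y i"
      unfolding i'(1) y_def prod.case by (rule lorentz_form_pos_root[OF h k i'(2)])
    show "y i > 0"
      unfolding i'(1) y_def prod.case using h i'(2) c_coeff_square(2)[OF h k i'(2)]
      by (intro mult_pos_pos add_nonneg_pos) auto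
  qed
  have "infsum f (roots L) = (1 + e (- s / 2)) * infsum (\<lambda>r. f (- r)) P"
  proof (rule infsum_branch_split)
    show "roots L = P \<union> uminus ` P"
      unfolding P_def by (rule roots_split[OF leech])
    show "P \<inter> uminus ` P = {}"
      by (auto simp: P_def)
    fix r assume "r \<in> P"
    then obtain i where i: "i \<in> I" "r = pos_root i"
      using bij by (auto simp: bij_betw_def)
    show "f r = e (- s / 2) * f (- r)"
      \<comment> \<open>The base of \<open>f r\<close> is \<open>- y i < 0\<close> and that of
        \<open>f (- r)\<close> is \<open>y i > 0\<close>.\<close>
      using neg_powr_branch[of "- y i" s] y[OF i(1)] by (simp add: f_def i(2) lorentz_form_uminus_left)
  qed (rule e_nonzero)
  also have "infsum (\<lambda>r. f (- r)) P = infsum (\<lambda>i. f (- pos_root i)) I"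
    by (rule infsum_reindex_bij_betw[OF bij, symmetric])
  also have "\<dots> = (\<Sum>\<^sub>\<infinity>((m, C), w)\<in>I. of_real (h * real m / 2) powr (- s) *
       of_real ((v - w + (1 / real m) *\<^sub>R rep C) \<bullet> (v - w + (1 / real m) *\<^sub>R rep C) + (c_coeff k h m)\<^sup>2) powr (- s))"
  proof (rule infsum_cong)
    fix i assume i: "i \<in> I"
    obtain m C w where i': "i = ((m, C), w)" "m \<ge> 1"
      using i by (auto simp: I_def)
    have "f (- pos_root i) = complex_of_real (y i) powr (- s)"
      by (simp add: f_def lorentz_form_uminus_left y(1)[OF i])
    also have "\<dots> = of_real (h * real m / 2) powr (- s) *
       of_real ((v - w + (1 / real m) *\<^sub>R rep C) \<bullet> (v - w + (1 / real m) *\<^sub>R rep C) + (c_coeff k h m)\<^sup>2) powr (- s)"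
      unfolding i'(1) y_def prod.case of_real_mult[of "h * real m / 2"]
      using h i'(2) by (intro powr_times_real_left) auto
    finally show "f (- pos_root i) = (case i of (x, xa) \<Rightarrow> (case x of (m, C) \<Rightarrow> \<lambda>w. of_real (h * real m / 2) powr (- s) *
       of_real ((v - w + (1 / real m) *\<^sub>R rep C) \<bullet> (v - w + (1 / real m) *\<^sub>R rep C) + (c_coeff k h m)\<^sup>2) powr (- s)) xa)"
      by (simp add: i')
  qed
  finally show ?thesis
    by (simp only: E_series_def f_def I_def)
qed

section \<open>Fourier coefficients\<close>

context
  fixes L :: "(real ^ 24) set" and h k :: real and s :: complex
  assumes leech: "leech_lattice L" and h: "h > 0" and k: "k > 0" "2 * h\<^sup>2 / k < 1"
    and s: "Re s > 25"
begin

lemma finite_root_cosets: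
  assumes "m \<ge> 1"
  shows "finite (root_cosets L m)" "card (root_cosets L m) \<le> m ^ 24"
proof -
  note Q = quotient_cong_mod_multiple[OF leech_full[OF leech] assms]
  have sub: "root_cosets L m \<subseteq> L // cong_mod_multiple L m"
    by (auto simp: root_cosets_def)
  show "finite (root_cosets L m)"
    using sub Q(1) by (rule finite_subset)
  show "card (root_cosets L m) \<le> m ^ 24"
    using card_mono[OF Q(1) sub] Q(2) by linarith
qed

text \<open>The argument stands for \<open>v - w\<close>. The character is taken at \<open>x\<close>
  and not at \<open>v\<close>, which changes nothing since \<open>l \<bullet> w\<close> is an
  integer, and makes the whole term a function of \<open>v - w\<close> as unfolding
  requires.\<close>

definition summand :: "real ^ 24 \<Rightarrow> nat \<times> (real ^ 24) set \<Rightarrow> real ^ 24 \<Rightarrow> complex" where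
  "summand l = (\<lambda>(m, C) x. of_real (h * real m / 2) powr (- s) *
     of_real ((x + (1 / real m) *\<^sub>R rep C) \<bullet> (x + (1 / real m) *\<^sub>R rep C) + (c_coeff k h m)\<^sup>2) powr (- s) *
     e (of_real (- (l \<bullet> x))))"

lemma summand_measurable: "summand l j \<in> borel_measurable borel"
  unfolding summand_def case_prod_beta
  by (intro borel_measurable_times measurable_compose[OF _ borel_measurable_of_real_powr]
            measurable_compose[OF _ borel_measurable_e]) auto

text \<open>Each L1 norm is at most \<open>b m * K\<close>, with \<open>K\<close> independent of
  \<open>m\<close> and of the coset. At most \<open>m ^ 24\<close> cosets and the factor
  \<open>m powr (- Re s)\<close> in \<open>b m\<close> leave a series of
  \<open>m powr (24 - Re s)\<close>.\<close>

lemma summand_nn_integral_finite: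
  "(\<integral>\<^sup>+j. (\<integral>\<^sup>+x. norm (summand l j x) \<partial>lborel) \<partial>count_space (Sigma {1..} (root_cosets L))) < \<infinity>"
proof -
  define p where "p m = (c_coeff k h m)\<^sup>2" for m
  define b where "b m = (h * real m / 2) powr (- Re s)" for m
  define F where "F q x = (x \<bullet> x + q) powr (- Re s)" for q and x :: "real ^ 24"
  define K where "K = (LINT x|lborel. F (p 1) x)"
  have p1: "p 1 > 0"
    unfolding p_def using c_coeff_square(2)[OF h k, of 1] by simp
  \<comment> \<open>At frequency 0 the character is 1, so integrability of \<open>F\<close> is a
    case of the Fourier lemma.\<close>
  have Fn: "F q x = norm (of_real (x \<bullet> x + q) powr (- s) * e (of_real ((0 :: real ^ 24) \<bullet> x)))" if "q > 0" for q x
    using that unfolding norm_mult norm_e_of_real F_def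
    by (subst norm_powr_real_powr) (auto intro: add_nonneg_pos)
  have "integrable lborel (F (p 1))"
    unfolding Fn[OF p1, abs_def] using s p1
    by (intro integrable_norm integrable_inverse_power_fourier) auto
  then have K: "(\<integral>\<^sup>+x. F (p 1) x \<partial>lborel) = ennreal K"
    unfolding K_def by (rule nn_integral_eq_integral) (simp add: F_def)
  have K0: "K \<ge> 0"
    unfolding K_def by (rule Bochner_Integration.integral_nonneg) (simp add: F_def)
  have bound: "(\<integral>\<^sup>+x. norm (summand l (m, C) x) \<partial>lborel) \<le> ennreal (b m * K)" if m: "m \<ge> 1" for m C
  proof -
    have pm: "p m > 0" "p m \<ge> p 1"
      unfolding p_def using c_coeff_square(2,3)[OF h k m] by auto
    have n: "norm (summand l (m, C) x) = b m * F (p m) (x + (1 / real m) *\<^sub>R rep C)" for x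
    proof -
      have "norm (of_real (h * real m / 2) powr (- s)) = b m"
        unfolding b_def using h m by (subst norm_powr_real_powr) auto
      moreover have "norm (of_real (y \<bullet> y + (c_coeff k h m)\<^sup>2) powr (- s)) = F (p m) y" for y :: "real ^ 24"
        unfolding F_def p_def using pm by (subst norm_powr_real_powr) (auto simp: p_def intro: add_nonneg_pos)
      ultimately show ?thesis
        unfolding summand_def prod.case norm_mult norm_e_of_real by simp
    qed
    have [measurable]: "F q \<in> borel_measurable borel" for q
      unfolding F_def by measurable
    have "(\<integral>\<^sup>+x. norm (summand l (m, C) x) \<partial>lborel)
        = (\<integral>\<^sup>+x. ennreal (b m) * ennreal (F (p m) (x + (1 / real m) *\<^sub>R rep C)) \<partial>lborel)"
      unfolding n by (simp add: b_def ennreal_mult F_def)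
    also have "\<dots> = ennreal (b m) * (\<integral>\<^sup>+x. ennreal (F (p m) (x + (1 / real m) *\<^sub>R rep C)) \<partial>lborel)"
      by (rule nn_integral_cmult) simp
    also have "(\<integral>\<^sup>+x. ennreal (F (p m) (x + (1 / real m) *\<^sub>R rep C)) \<partial>lborel) = (\<integral>\<^sup>+x. ennreal (F (p m) x) \<partial>lborel)"
      by (rule nn_integral_lborel_translate) simp
    \<comment> \<open>The power decreases as the added constant grows, and
      \<open>p m \<ge> p 1\<close>.\<close>
    also have "\<dots> \<le> (\<integral>\<^sup>+x. ennreal (F (p 1) x) \<partial>lborel)"
      unfolding F_def using pm p1 s
      by (intro nn_integral_mono ennreal_leI powr_mono2') (auto intro: add_nonneg_pos)
    also have "ennreal (b m) * (\<integral>\<^sup>+x. ennreal (F (p 1) x) \<partial>lborel) = ennreal (b m * K)"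
      unfolding K using K0 by (simp add: ennreal_mult b_def)
    finally show ?thesis
      by (simp add: mult_left_mono)
  qed
  have "(\<lambda>(m, C). b m * K) summable_on Sigma {1..} (root_cosets L)"
  proof (rule summable_on_SigmaI)
    show "((\<lambda>C. case (m, C) of (m, C) \<Rightarrow> b m * K) has_sum real (card (root_cosets L m)) * (b m * K)) (root_cosets L m)"
      if "m \<in> {1..}" for m
      using finite_root_cosets(1)[of m] that by (intro has_sum_finiteI) auto
    \<comment> \<open>The exponent is below -1 exactly when \<open>Re s > 25\<close>.\<close>
    have "summable (\<lambda>m. real m powr (24 - Re s))"
      using s by (simp add: summable_real_powr_iff)
    then have "(\<lambda>m. real m powr (24 - Re s)) summable_on UNIV"
      by (subst summable_on_UNIV_nonneg_real_iff) auto
    then have "(\<lambda>m. real m powr (24 - Re s)) summable_on {1..}"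
      by (rule summable_on_subset_banach) auto
    then have "(\<lambda>m. ((h / 2) powr (- Re s) * K) * real m powr (24 - Re s)) summable_on {1..}"
      by (rule summable_on_cmult_right)
    then show "(\<lambda>m. real (card (root_cosets L m)) * (b m * K)) summable_on {1..}"
    proof (rule summable_on_comparison_test)
      fix m :: nat assume "m \<in> {1..}"
      then have m: "m \<ge> 1" by simp
      have "real (card (root_cosets L m)) \<le> real m ^ 24"
        using finite_root_cosets(2)[OF m] by (metis of_nat_le_iff of_nat_power)
      then have "real (card (root_cosets L m)) * (b m * K) \<le> real m ^ 24 * (b m * K)"
        using K0 by (intro mult_right_mono) (auto simp: b_def)
      also have "real m ^ 24 = real m powr 24"
        using m by simp
      finally have le: "real (card (root_cosets L m)) * (b m * K) \<le> real m powr 24 * (b m * K)" .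
      have b: "b m = (h / 2) powr (- Re s) * real m powr (- Re s)"
        using h by (simp add: b_def flip: powr_mult)
      note le
      also have "real m powr 24 * (b m * K)
          = ((h / 2) powr (- Re s) * K) * (real m powr 24 * real m powr (- Re s))"
        by (simp only: b mult_ac)
      also have "real m powr 24 * real m powr (- Re s) = real m powr (24 - Re s)"
        using powr_add[of "real m" 24 "- Re s"] by (simp only: add_uminus_conv_diff)
      finally show "real (card (root_cosets L m)) * (b m * K)
          \<le> ((h / 2) powr (- Re s) * K) * real m powr (24 - Re s)" .
      show "0 \<le> real (card (root_cosets L m)) * (b m * K)"
        using K0 by (simp add: b_def)
    qed
  qed (use K0 in \<open>auto simp: b_def\<close>)
  then have "(\<integral>\<^sup>+j. ennreal (case j of (m, C) \<Rightarrow> b m * K) \<partial>count_space (Sigma {1..} (root_cosets L))) < \<infinity>"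
    by (rule nn_integral_count_space_finite_of_summable) (use K0 in \<open>auto simp: b_def\<close>)
  moreover have "(\<integral>\<^sup>+j. (\<integral>\<^sup>+x. norm (summand l j x) \<partial>lborel) \<partial>count_space (Sigma {1..} (root_cosets L)))
      \<le> (\<integral>\<^sup>+j. ennreal (case j of (m, C) \<Rightarrow> b m * K) \<partial>count_space (Sigma {1..} (root_cosets L)))"
    by (intro nn_integral_mono) (auto intro: bound)
  ultimately show ?thesis
    by (rule le_less_trans[rotated])
qed

text \<open>Translating by \<open>rep C / m\<close> centres the inverse power at the origin; the
  character then splits off a constant phase, the only trace of the coset.\<close>

lemma integral_summand:
  "(LINT x|lborel. summand l (m, C) x) = of_real (h * real m / 2) powr (- s) *
     (LINT x|lborel. of_real (x \<bullet> x + (c_coeff k h m)\<^sup>2) powr (- s) * e (of_real ((- l) \<bullet> x))) *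
     e (of_real (l \<bullet> rep C / real m))"
proof -
  define F where "F y = of_real (h * real m / 2) powr (- s) *
     (of_real (y \<bullet> y + (c_coeff k h m)\<^sup>2) powr (- s) * e (of_real ((- l) \<bullet> y))) *
     e (of_real (l \<bullet> rep C / real m))" for y :: "real ^ 24"
  have [measurable]: "F \<in> borel_measurable borel"
    unfolding F_def
    by (intro borel_measurable_times measurable_compose[OF _ borel_measurable_of_real_powr]
            measurable_compose[OF _ borel_measurable_e]) auto
  have "summand l (m, C) x = F (x + (1 / real m) *\<^sub>R rep C)" for x
  proof -
    have "- (l \<bullet> x) = (- l) \<bullet> (x + (1 / real m) *\<^sub>R rep C) + l \<bullet> rep C / real m"
      by (simp add: inner_add_right)
    then have "e (of_real (- (l \<bullet> x)))
        = e (of_real ((- l) \<bullet> (x + (1 / real m) *\<^sub>R rep C))) * e (of_real (l \<bullet> rep C / real m))"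
      by (metis e_add of_real_add)
    then show ?thesis
      by (simp only: summand_def F_def prod.case mult.assoc)
  qed
  then have "(LINT x|lborel. summand l (m, C) x) = (LINT x|lborel. F x)"
    using integral_lborel_translate[of F "(1 / real m) *\<^sub>R rep C"] by simp
  then show ?thesis
    by (simp only: F_def integral_mult_left_zero integral_mult_right_zero)
qed

text \<open>The sum over \<open>w\<close> unfolds the integral over the Voronoi cell, which has
  volume 1 by self-duality. For fixed \<open>m\<close> the whole-space integrals differ only in
  their phases, and these add up to \<open>j_sum\<close>.\<close>

lemma fourier_coeff_expansion:
  assumes l: "l \<in> L"
  defines "X \<equiv> \<lambda>m. of_real (h * real m / 2) powr (- s) *
     (LINT x|lborel. of_real (x \<bullet> x + (c_coeff k h m)\<^sup>2) powr (- s) * e (of_real ((- l) \<bullet> x))) *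
     j_sum L l m"
  shows "X summable_on {1..}" "fourier_coeff L l k h s = (1 + e (- s / 2)) * infsum X {1..}"
proof -
  define V where "V = voronoi_cell L"
  define J where "J = Sigma {1..} (root_cosets L)"
  note full = leech_full[OF leech]
  have "countable J"
    unfolding J_def
  proof (rule countable_SIGMA)
    show "countable (root_cosets L m)" if "m \<in> {1..}" for m
      using finite_root_cosets(1)[of m] that by (simp add: countable_finite)
  qed simp
  then have "((\<lambda>j. LINT x|lborel. summand l j x) has_sum
      (LINT x:V|lborel. (\<Sum>\<^sub>\<infinity>(j, w)\<in>J \<times> L. summand l j (x - w)))) J"
    unfolding V_def
    by (intro has_sum_unfold fundamental_domain_voronoi_cell full countable_full_lattice summand_measurable)
       (use summand_nn_integral_finite in \<open>simp_all add: J_def\<close>)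
  then have X: "(X has_sum (LINT x:V|lborel. (\<Sum>\<^sub>\<infinity>(j, w)\<in>J \<times> L. summand l j (x - w)))) {1..}"
    unfolding J_def
  proof (rule has_sum_SigmaD)
    fix m :: nat assume m: "m \<in> {1..}"
    \<comment> \<open>Finitely many cosets for each \<open>m\<close>: the common factors are pulled
      out of the sum of phases.\<close>
    show "((\<lambda>C. LINT x|lborel. summand l (m, C) x) has_sum X m) (root_cosets L m)"
      using m by (intro has_sum_finiteI finite_root_cosets)
        (simp_all only: integral_summand X_def sum_distrib_left[symmetric] atLeast_iff j_sum_eq_sum_rep[OF leech _ l])
  qed
  then show "X summable_on {1..}"
    by (auto simp: summable_on_def)
  have "E_series L (\<phi> k h v) s * e (- complex_of_real (l \<bullet> v))
      = (1 + e (- s / 2)) * (\<Sum>\<^sub>\<infinity>(j, w)\<in>J \<times> L. summand l j (v - w))" for v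
  proof -
    have ew: "e (of_real (- (l \<bullet> (v - w)))) = e (- complex_of_real (l \<bullet> v))" if w: "w \<in> L" for w
    proof -
      obtain n where n: "l \<bullet> w = of_int n"
        using leech_inner_Ints[OF leech l w] by (auto elim: Ints_cases)
      have "complex_of_real (- (l \<bullet> (v - w))) = - complex_of_real (l \<bullet> v) + of_int n"
        by (simp add: inner_diff_right n)
      then show ?thesis
        by (simp only: e_add e_of_int mult_1_right)
    qed
    show ?thesis
      unfolding E_series_eq[OF leech h k] mult.assoc infsum_cmult_left'[symmetric] J_def[symmetric]
      by (rule arg_cong2[where f = "(*)"], rule refl, rule infsum_cong)
         (auto simp: summand_def ew simp del: of_real_minus)
  qed
  then have "fourier_coeff L l k h s
      = (LINT v:V|lborel. (1 + e (- s / 2)) * (\<Sum>\<^sub>\<infinity>(j, w)\<in>J \<times> L. summand l j (v - w)))"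
    using leech measure_voronoi_cell_self_dual[OF full]
    by (simp add: fourier_coeff_def torus_integral_def leech_lattice_def V_def)
  also have "\<dots> = (1 + e (- s / 2)) * (LINT v:V|lborel. (\<Sum>\<^sub>\<infinity>(j, w)\<in>J \<times> L. summand l j (v - w)))"
    by (rule set_integral_mult_right)
  also have "(LINT v:V|lborel. (\<Sum>\<^sub>\<infinity>(j, w)\<in>J \<times> L. summand l j (v - w))) = infsum X {1..}"
    using infsumI[OF X] by simp
  finally show "fourier_coeff L l k h s = (1 + e (- s / 2)) * infsum X {1..}" .
qed

end

section \<open>Collecting powers and separating the two cases\<close>

lemma of_real_powr_eq_exp: "x > 0 \<Longrightarrow> complex_of_real x powr z = exp (z * of_real (ln x))"
  by (simp add: powr_def Ln_of_real)

text \<open>All bases are positive, so the powers become exponentials of real logarithms; those of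
  \<open>h\<close> and 2 cancel. This explains the normalising factor
  \<open>(h / (2 * pi)) powr s\<close>.\<close>

lemma scaling_factor:
  fixes s :: complex
  assumes "h > 0" "m \<ge> 1"
  shows "complex_of_real (h / (2 * pi)) powr s * of_real (h * real m / 2) powr (- s) * of_real (pi powr 12)
      = of_real pi powr (12 - s) * of_nat m powr (- s)"
proof -
  have pos: "h / (2 * pi) > 0" "h * real m / 2 > 0" "real m > 0"
    using assms by auto
  have pi12: "complex_of_real (pi powr 12) = exp (12 * of_real (ln pi))"
    by (simp add: powr_def flip: exp_of_real)
  have nat: "of_nat m powr (- s) = exp (- s * of_real (ln (real m)))"
    using of_real_powr_eq_exp[OF pos(3), of "- s"] by simp
  have ln: "ln (h / (2 * pi)) = ln h - ln 2 - ln pi" "ln (h * real m / 2) = ln h + ln (real m) - ln 2"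
    using assms by (simp_all add: ln_div ln_mult)
  show ?thesis
    unfolding of_real_powr_eq_exp[OF pos(1)] of_real_powr_eq_exp[OF pos(2)] of_real_powr_eq_exp[OF pi_gt_zero]
      pi12 nat ln exp_add[symmetric] by (simp add: algebra_simps)
qed

theorem theorem4p2:
  fixes \<Lambda> :: "(real ^ 24) set" and h k :: real and l :: "real ^ 24" and s :: complex
  assumes "leech_lattice \<Lambda>"
    and "h > 0" and "k > 0" and "2 * h\<^sup>2 / k < 1"
    and "l \<in> \<Lambda>"
    and "Re s > 25"
  shows "(l \<noteq> 0 \<longrightarrow>
           (\<lambda>n. j_sum \<Lambda> l n * of_nat n powr (- s) * of_real (c_coeff k h n) powr (12 - s)
                  * Bessel_K (12 - s) (2 * pi * norm l * c_coeff k h n)) summable_on {1..}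
         \<and> fourier_coeff_star \<Lambda> l k h s =
             2 * (1 + e (- s / 2)) * of_real (norm l) powr (s - 12)
               * (\<Sum>\<^sub>\<infinity>n\<in>{1..}. j_sum \<Lambda> l n * of_nat n powr (- s)
                     * of_real (c_coeff k h n) powr (12 - s)
                     * Bessel_K (12 - s) (2 * pi * norm l * c_coeff k h n)))
       \<and> (l = 0 \<longrightarrow>
           (\<lambda>n. j_sum \<Lambda> 0 n * of_nat n powr (- s) * of_real (c_coeff k h n) powr (24 - 2 * s))
             summable_on {1..}
         \<and> fourier_coeff_star \<Lambda> 0 k h s =
             (1 + e (- s / 2)) * Gamma (s - 12) * of_real pi powr (12 - s)
               * (\<Sum>\<^sub>\<infinity>n\<in>{1..}. j_sum \<Lambda> 0 n * of_nat n powr (- s)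
                     * of_real (c_coeff k h n) powr (24 - 2 * s)))"
proof -
  define P where "P n = (LINT x::real^24|lborel. of_real (x \<bullet> x + (c_coeff k h n)\<^sup>2) powr (- s) * e (of_real ((- l) \<bullet> x)))" for n
  define X where "X n = of_real (h * real n / 2) powr (- s) * P n * j_sum \<Lambda> l n" for n
  define A where "A = complex_of_real (h / (2 * pi)) powr s * Gamma s"
  have X: "X summable_on {1..}" "fourier_coeff \<Lambda> l k h s = (1 + e (- s / 2)) * infsum X {1..}"
    using fourier_coeff_expansion[OF assms(1-4,6,5)] unfolding X_def P_def by auto
  \<comment> \<open>Both cases pull out a constant \<open>D\<close>; it must be nonzero for
    summability to pass back to \<open>T\<close>.\<close>
  have star: "T summable_on {1..} \<and> fourier_coeff_star \<Lambda> l k h s = (1 + e (- s / 2)) * (D * infsum T {1..})"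
    if D: "D \<noteq> 0" and T: "\<And>n. n \<ge> 1 \<Longrightarrow> A * X n = D * T n" for D T
  proof
    have "(\<lambda>n. A * X n) summable_on {1..}"
      using X(1) by (rule summable_on_cmult_right)
    also have "?this \<longleftrightarrow> (\<lambda>n. D * T n) summable_on {1..}"
      using T by (intro summable_on_cong) auto
    finally show "T summable_on {1..}"
      using D by (simp add: summable_on_cmult_right')
    have "A * infsum X {1..} = (\<Sum>\<^sub>\<infinity>n\<in>{1..}. A * X n)"
      by (simp add: infsum_cmult_right')
    also have "\<dots> = (\<Sum>\<^sub>\<infinity>n\<in>{1..}. D * T n)"
      using T by (intro infsum_cong) auto
    also have "\<dots> = D * infsum T {1..}"
      by (simp add: infsum_cmult_right')
    finally show "fourier_coeff_star \<Lambda> l k h s = (1 + e (- s / 2)) * (D * infsum T {1..})"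
      by (simp add: fourier_coeff_star_def X(2) A_def mult_ac)
  qed
  note c = c_coeff_square(2)[OF assms(2-4)]
  have s: "Re (s - 12) > 0"
    using assms(6) by simp
  have GP: "Gamma s * P n = of_real (pi powr 12) * (LINT t|lborel. indicator {0<..} t *\<^sub>R
            (of_real t powr (s - 12 - 1) * of_real (exp (- (c_coeff k h n)\<^sup>2 * t - pi\<^sup>2 * (l \<bullet> l) / t))))"
    if "n \<ge> 1" for n
    using integral_inverse_power_fourier[of s "(c_coeff k h n)\<^sup>2" "- l"] assms(6) c[OF that]
    by (simp add: P_def)
  \<comment> \<open>Only the remaining integral over \<open>t\<close> depends on whether
    \<open>l\<close> vanishes.\<close>
  have AX: "A * X n = of_real pi powr (12 - s) * of_nat n powr (- s) * j_sum \<Lambda> l n *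
      (LINT t|lborel. indicator {0<..} t *\<^sub>R
            (of_real t powr (s - 12 - 1) * of_real (exp (- (c_coeff k h n)\<^sup>2 * t - pi\<^sup>2 * (l \<bullet> l) / t))))"
    if n: "n \<ge> 1" for n
  proof -
    have "A * X n = complex_of_real (h / (2 * pi)) powr s * of_real (h * real n / 2) powr (- s) *
        (Gamma s * P n) * j_sum \<Lambda> l n"
      unfolding A_def X_def by (simp only: mult_ac)
    then show ?thesis
      unfolding GP[OF n] scaling_factor[OF assms(2) n, of s, symmetric] by (simp only: mult_ac)
  qed
  show ?thesis
  proof (intro conjI impI)
    assume l: "l \<noteq> 0"
    have T: "A * X n = (2 * of_real (norm l) powr (s - 12)) *
        (j_sum \<Lambda> l n * of_nat n powr (- s) * of_real (c_coeff k h n) powr (12 - s)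
                  * Bessel_K (12 - s) (2 * pi * norm l * c_coeff k h n))" if n: "n \<ge> 1" for n
    proof -
      let ?c = "c_coeff k h n"
      \<comment> \<open>The Bessel integral is applied with \<open>p = ?c\<^sup>2\<close> and
        \<open>b = pi\<^sup>2 * (l \<bullet> l)\<close>; \<open>b > 0\<close> because
        \<open>l \<noteq> 0\<close>.\<close>
      have "sqrt (pi\<^sup>2 * (l \<bullet> l) / ?c\<^sup>2) = pi * norm l / ?c" "sqrt (?c\<^sup>2 * (pi\<^sup>2 * (l \<bullet> l))) = pi * norm l * ?c"
        using c[OF n] by (simp_all add: real_sqrt_divide real_sqrt_mult norm_eq_sqrt_inner)
      then have int: "(LINT t|lborel. indicator {0<..} t *\<^sub>R
            (of_real t powr (s - 12 - 1) * of_real (exp (- ?c\<^sup>2 * t - pi\<^sup>2 * (l \<bullet> l) / t))))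
          = 2 * of_real (pi * norm l / ?c) powr (s - 12) * Bessel_K (s - 12) (2 * pi * norm l * ?c)"
        using Bessel_K_integral[OF s, of "?c\<^sup>2" "pi\<^sup>2 * (l \<bullet> l)"] c[OF n] l by (simp add: mult_ac)
      \<comment> \<open>The Bessel integral has order \<open>s - 12\<close>; evenness in the order
        gives the stated \<open>12 - s\<close>.\<close>
      have K: "Bessel_K (s - 12) = Bessel_K (12 - s)"
        using Bessel_K_minus[of "12 - s"] by (simp add: fun_eq_iff)
      have pow: "of_real pi powr (12 - s) * of_real (pi * norm l / ?c) powr (s - 12)
          = of_real (norm l) powr (s - 12) * of_real ?c powr (12 - s)"
      proof -
        have pos: "pi * norm l / ?c > 0" "norm l > 0"
          using c[OF n] l by auto
        have ln: "ln (pi * norm l / ?c) = ln pi + ln (norm l) - ln ?c"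
          using c[OF n] l by (simp add: ln_div ln_mult)
        show ?thesis
          unfolding of_real_powr_eq_exp[OF pi_gt_zero] of_real_powr_eq_exp[OF pos(1)]
            of_real_powr_eq_exp[OF pos(2)] of_real_powr_eq_exp[OF c[OF n]] ln exp_add[symmetric]
          by (simp add: algebra_simps)
      qed
      have "A * X n = 2 * (of_real pi powr (12 - s) * of_real (pi * norm l / ?c) powr (s - 12)) *
          (j_sum \<Lambda> l n * of_nat n powr (- s) * Bessel_K (12 - s) (2 * pi * norm l * ?c))"
        unfolding AX[OF n] int K by (simp only: mult_ac)
      then show ?thesis
        unfolding pow by (simp only: mult_ac)
    qed
    have D: "2 * complex_of_real (norm l) powr (s - 12) \<noteq> 0"
      using l by simp
    show "(\<lambda>n. j_sum \<Lambda> l n * of_nat n powr (- s) * of_real (c_coeff k h n) powr (12 - s)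
                  * Bessel_K (12 - s) (2 * pi * norm l * c_coeff k h n)) summable_on {1..}"
      using star[OF D T] by blast
    show "fourier_coeff_star \<Lambda> l k h s =
             2 * (1 + e (- s / 2)) * of_real (norm l) powr (s - 12)
               * (\<Sum>\<^sub>\<infinity>n\<in>{1..}. j_sum \<Lambda> l n * of_nat n powr (- s)
                     * of_real (c_coeff k h n) powr (12 - s)
                     * Bessel_K (12 - s) (2 * pi * norm l * c_coeff k h n))"
      using star[OF D T] by (simp only: mult_ac)
  next
    assume l: "l = 0"
    have T: "A * X n = (Gamma (s - 12) * of_real pi powr (12 - s)) *
        (j_sum \<Lambda> 0 n * of_nat n powr (- s) * of_real (c_coeff k h n) powr (24 - 2 * s))" if n: "n \<ge> 1" for n
    proof -
      let ?c = "c_coeff k h n"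
      \<comment> \<open>For \<open>l = 0\<close> the factor
        \<open>exp (- pi\<^sup>2 * (l \<bullet> l) / t)\<close> is 1, and a plain Gamma integral
        remains.\<close>
      have "(LINT t|lborel. indicator {0<..} t *\<^sub>R
            (of_real t powr (s - 12 - 1) * of_real (exp (- ?c\<^sup>2 * t - pi\<^sup>2 * (l \<bullet> l) / t))))
          = Gamma (s - 12) * of_real (?c\<^sup>2) powr (- (s - 12))"
        using Gamma_integral_scaled[OF s, of "?c\<^sup>2"] c[OF n] by (simp add: l has_bochner_integral_iff)
      moreover have "of_real (?c\<^sup>2) powr (- (s - 12)) = of_real ?c powr (24 - 2 * s)"
      proof -
        have "ln (?c\<^sup>2) = 2 * ln ?c"
          using c[OF n] by (simp add: ln_realpow)
        then show ?thesis
          using c[OF n] by (simp add: of_real_powr_eq_exp algebra_simps del: of_real_power)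
      qed
      ultimately show ?thesis
        unfolding AX[OF n] by (simp only: l mult_ac)
    qed
    \<comment> \<open>\<open>Gamma\<close> vanishes here only at its poles, where its value is 0 by
      convention; these have nonpositive real part.\<close>
    have "Gamma (s - 12) \<noteq> 0"
    proof
      assume "Gamma (s - 12) = 0"
      then obtain n where n: "s - 12 = of_int n" "n \<le> 0"
        unfolding Gamma_eq_zero_iff by (rule nonpos_Ints_cases)
      then have "Re (s - 12) = of_int n"
        by (simp only: complex_Re_of_int)
      with s n(2) show False
        by simp
    qed
    then have D: "Gamma (s - 12) * complex_of_real pi powr (12 - s) \<noteq> 0"
      by simp
    show "(\<lambda>n. j_sum \<Lambda> 0 n * of_nat n powr (- s) * of_real (c_coeff k h n) powr (24 - 2 * s))
             summable_on {1..}"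
      using star[OF D T] by blast
    show "fourier_coeff_star \<Lambda> 0 k h s =
             (1 + e (- s / 2)) * Gamma (s - 12) * of_real pi powr (12 - s)
               * (\<Sum>\<^sub>\<infinity>n\<in>{1..}. j_sum \<Lambda> 0 n * of_nat n powr (- s)
                     * of_real (c_coeff k h n) powr (24 - 2 * s))"
      using star[OF D T] by (simp only: l mult_ac)
  qed
qed

end
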